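(* With the Aztec diamond notation of the context, suppose that $d_{i,j}=d_i$ for all $0\le i,j\le k-1$ (the weights of each column of vertical edges are constant). Let $\tilde a$ be the weights given by $\tilde c_{i,j}=c_{i,[j+1]_{k+1}}$ for $0\le i,j\le k$ and $\tilde d_{i,j}=d_i$ for $0\le i,j\le k-1$. Then for every Kasteleyn orientation $\varphi$ of $A_k$, $$Z(A_k,a,\varphi)=(-1)^kZ(A_k,\tilde a,\varphi),$$ and $Y(A_k,a)=Y(A_k,\tilde a)$.
   Context: Fix $k\geq1$. Let $G^\bullet$ be the planar graph with vertices $b_r$, $\tilde b$ and $b_{i,j}$ ($0\le i\le k-1$, $0\le j\le k$), drawn with $b_{i,j}$ at $(i+1,j)$, $b_r$ to the left and $\tilde b$ to the right of everything. Its edges are the horizontal edges $e_{i,j}$ ($0\le i,j\le k$) joining $b_{i-1,j}$ and $b_{i,j}$, with $b_{-1,j}:=b_r$, $b_{k,j}:=\tilde b$, and the vertical edges $g_{i,j}$ ($0\le i,j\le k-1$) joining $b_{i,j}$ and $b_{i,j+1}$. Let $F$ be the set of edges of $G^\bullet$, with weights $a$: $c_{i,j}$ on $e_{i,j}$, $d_{i,j}$ on $g_{i,j}$. Let $B=\{b_{i,j}\}$ and $W$ the set of bounded faces of $G^\bullet$. The Aztec diamond $A_k$ is the bipartite planar graph on $W\sqcup B$ with $w\sim b$ iff $b$ lies on $\partial w$; $f(w,b)\in F$ (resp. $f(b,w)$) is the edge of $\partial w$ incident to $b$ traversed just before (resp. after) $b$ in a counterclockwise traversal of $\partial w$. A Kasteleyn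 orientation of $A_k$ is a skew-symmetric $\varphi$ from directed edges to $\{\pm1\}$ with $\prod_{wb\in\partial f}\varphi_{(w,b)}=(-1)^{\ell+1}$ for every bounded face of $A_k$ of degree $2\ell$; $Z(A_k,a,\varphi)=\sum_{\mathsf M}\prod_{wb\in\mathsf M}\varphi_{(w,b)}(a_{f(w,b)}-a_{f(b,w)})$ over perfect matchings of $A_k$; $Y(A_k,a)=\bigl(\prod_{f\in F}a_f\bigr)\frac{Z(A_k,a^{-1},\varphi)}{Z(A_k,a,\varphi)}$, independent of $\varphi$. $[n]_r$ is the residue of $n$ modulo $r$ in $\{0,\dots,r-1\}$. *)

theory Defs
  imports Complex_Main "HOL-Combinatorics.Orbits"
begin

section \<open>Plane graphs as rotation systems\<close>

text \<open>
  A connected simple plane graph is given by its vertex set and, for every vertex, the list of its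
  neighbours in counterclockwise order (only the cyclic order matters).  A dart \<open>(u, v)\<close> is an
  edge directed from \<open>u\<close> to \<open>v\<close>.  Following the boundary of the face on the left of \<open>(u, v)\<close>, one
  leaves \<open>v\<close> towards the neighbour that precedes \<open>u\<close> counterclockwise.  A face is thus an orbit of
  \<open>face_step\<close>, i.e. the set of the darts on its boundary having the face on their left, so that a
  bounded face is traversed counterclockwise.
\<close>

type_synonym 'v rotation = "'v \<Rightarrow> 'v list"

definition cyclic_pred :: "'v list \<Rightarrow> 'v \<Rightarrow> 'v" where
  "cyclic_pred xs x = (THE y. \<exists>n<length xs. xs ! n = y \<and> xs ! (Suc n mod length xs) = x)"

definition face_step :: "'v rotation \<Rightarrow> 'v \<times> 'v \<Rightarrow> 'v \<times> 'v" where
  "face_step R = (\<lambda>(u, v). (v, cyclic_pred (R v) u))"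

definition face_left :: "'v rotation \<Rightarrow> 'v \<times> 'v \<Rightarrow> ('v \<times> 'v) set" where
  "face_left R x = orbit (face_step R) x"

definition faces :: "'v set \<Rightarrow> 'v rotation \<Rightarrow> ('v \<times> 'v) set set" where
  "faces V R = {face_left R (u, v) | u v. u \<in> V \<and> v \<in> set (R u)}"


section \<open>The graph \<open>G\<^sup>\<bullet>\<close>\<close>

text \<open>
  \<open>BL\<close> and \<open>BR\<close> are the extreme vertices \<open>b\<^sub>r\<close> (on the left) and \<open>b~\<close> (on the right); \<open>BV i j\<close> is
  \<open>b\<^sub>i\<^sub>,\<^sub>j\<close>.  \<open>Hor i j\<close> and \<open>Ver i j\<close> are the edges \<open>e\<^sub>i\<^sub>,\<^sub>j\<close> and \<open>g\<^sub>i\<^sub>,\<^sub>j\<close>.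
\<close>

datatype vert = BL | BR | BV nat nat

datatype edge = Hor nat nat | Ver nat nat

definition left_end :: "nat \<Rightarrow> nat \<Rightarrow> vert" where
  "left_end i j = (if i = 0 then BL else BV (i - 1) j)"

definition right_end :: "nat \<Rightarrow> nat \<Rightarrow> nat \<Rightarrow> vert" where
  "right_end k i j = (if i = k then BR else BV i j)"

fun ends :: "nat \<Rightarrow> edge \<Rightarrow> vert set" where
  "ends k (Hor i j) = {left_end i j, right_end k i j}"
| "ends k (Ver i j) = {BV i j, BV i (j + 1)}"

definition edges :: "nat \<Rightarrow> edge set" where
  "edges k = {Hor i j | i j. i \<le> k \<and> j \<le> k} \<union> {Ver i j | i j. i < k \<and> j < k}"

definition blacks :: "nat \<Rightarrow> vert set" where
  "blacks k = {BV i j | i j. i < k \<and> j \<le> k}"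

definition verts :: "nat \<Rightarrow> vert set" where
  "verts k = {BL, BR} \<union> blacks k"

text \<open>The neighbours of \<open>b\<^sub>i\<^sub>,\<^sub>j\<close> are listed in the order east, north, west, south.\<close>

fun rot_G :: "nat \<Rightarrow> vert rotation" where
  "rot_G k BL = map (BV 0) [0..<k + 1]"
| "rot_G k BR = rev (map (BV (k - 1)) [0..<k + 1])"
| "rot_G k (BV i j) =
     [right_end k (i + 1) j] @ (if j < k then [BV i (j + 1)] else []) @
     [left_end i j] @ (if j > 0 then [BV i (j - 1)] else [])"

type_synonym face = "(vert \<times> vert) set"

text \<open>The top edge \<open>e\<^sub>0\<^sub>,\<^sub>k\<close>, directed to the right, has the unbounded face on its left.\<close>

definition outer_face_G :: "nat \<Rightarrow> face" where
  "outer_face_G k = face_left (rot_G k) (BL, BV 0 k)"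

definition whites :: "nat \<Rightarrow> face set" where
  "whites k = faces (verts k) (rot_G k) - {outer_face_G k}"


section \<open>The Aztec diamond\<close>

text \<open>An edge of \<open>A\<^sub>k\<close> is represented by the pair \<open>(w, b)\<close> of its endpoints.\<close>

definition edges_A :: "nat \<Rightarrow> (face \<times> vert) set" where
  "edges_A k = {(w, b). w \<in> whites k \<and> b \<in> blacks k \<and> (\<exists>u. (u, b) \<in> w)}"

text \<open>\<open>f_before k w b\<close> is \<open>f(w, b)\<close> and \<open>f_after k b w\<close> is \<open>f(b, w)\<close>.\<close>

definition f_before :: "nat \<Rightarrow> face \<Rightarrow> vert \<Rightarrow> edge" where
  "f_before k w b = (THE e. e \<in> edges k \<and> (\<exists>u. (u, b) \<in> w \<and> ends k e = {u, b}))"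

definition f_after :: "nat \<Rightarrow> vert \<Rightarrow> face \<Rightarrow> edge" where
  "f_after k b w = (THE e. e \<in> edges k \<and> (\<exists>v. (b, v) \<in> w \<and> ends k e = {b, v}))"

datatype avert = White face | Black vert

definition verts_A :: "nat \<Rightarrow> avert set" where
  "verts_A k = White ` whites k \<union> Black ` blacks k"

text \<open>The vertices of \<open>G\<^sup>\<bullet>\<close> met along the boundary of the face \<open>w\<close>, from some starting point.\<close>

definition boundary_walk :: "nat \<Rightarrow> face \<Rightarrow> vert list" where
  "boundary_walk k w =
     (let x = (SOME x. x \<in> w) in map (\<lambda>n. fst ((face_step (rot_G k) ^^ n) x)) [0..<card w])"

text \<open>
  The embedding of \<open>A\<^sub>k\<close>: each \<open>w\<close> is placed inside the corresponding face and joined to the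
  vertices of \<open>B\<close> on its boundary.  Counterclockwise around \<open>w\<close> one sees these vertices in
  boundary order; counterclockwise around \<open>b\<close> one sees the faces at \<open>b\<close>, the face on the left of
  \<open>(b, v)\<close> coming immediately after the edge to \<open>v\<close>.
\<close>

fun rot_A :: "nat \<Rightarrow> avert rotation" where
  "rot_A k (White w) = map Black (filter (\<lambda>b. b \<in> blacks k) (boundary_walk k w))"
| "rot_A k (Black b) =
     map White (filter (\<lambda>w. w \<in> whites k) (map (\<lambda>v. face_left (rot_G k) (b, v)) (rot_G k b)))"

text \<open>
  The face of \<open>G\<^sup>\<bullet>\<close> with vertices \<open>b\<^sub>r\<close>, \<open>b\<^sub>0\<^sub>,\<^sub>0\<close>, \<open>b\<^sub>0\<^sub>,\<^sub>1\<close> is on the left of the edge from \<open>b\<^sub>0\<^sub>,\<^sub>0\<close>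
  up to \<open>b\<^sub>0\<^sub>,\<^sub>1\<close>.  It is a leftmost vertex of \<open>A\<^sub>k\<close>, and the edge of \<open>A\<^sub>k\<close> from it up to \<open>b\<^sub>0\<^sub>,\<^sub>1\<close> has
  the unbounded face of \<open>A\<^sub>k\<close> on its left.
\<close>

definition outer_face_A :: "nat \<Rightarrow> (avert \<times> avert) set" where
  "outer_face_A k =
     face_left (rot_A k) (White (face_left (rot_G k) (BV 0 0, BV 0 1)), Black (BV 0 1))"

definition bounded_faces_A :: "nat \<Rightarrow> (avert \<times> avert) set set" where
  "bounded_faces_A k = faces (verts_A k) (rot_A k) - {outer_face_A k}"

definition kasteleyn_orientation :: "nat \<Rightarrow> (avert \<times> avert \<Rightarrow> int) \<Rightarrow> bool" where
  "kasteleyn_orientation k \<phi> \<longleftrightarrow>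
     (\<forall>(w, b) \<in> edges_A k. \<phi> (White w, Black b) \<in> {1, -1} \<and>
        \<phi> (Black b, White w) = - \<phi> (White w, Black b)) \<and>
     (\<forall>f \<in> bounded_faces_A k. \<forall>l. card f = 2 * l \<longrightarrow>
        (\<Prod>(w, b) \<in> {(w, b). (White w, Black b) \<in> f \<or> (Black b, White w) \<in> f}.
           \<phi> (White w, Black b)) = (-1) ^ (l + 1))"

definition perfect_matchings :: "nat \<Rightarrow> (face \<times> vert) set set" where
  "perfect_matchings k =
     {M. M \<subseteq> edges_A k \<and> (\<forall>w \<in> whites k. \<exists>!b. (w, b) \<in> M) \<and> (\<forall>b \<in> blacks k. \<exists>!w. (w, b) \<in> M)}"

definition Z :: "nat \<Rightarrow> (edge \<Rightarrow> 'a::field) \<Rightarrow> (avert \<times> avert \<Rightarrow> int) \<Rightarrow> 'a" where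
  "Z k a \<phi> = (\<Sum>M \<in> perfect_matchings k.
     \<Prod>(w, b) \<in> M. of_int (\<phi> (White w, Black b)) * (a (f_before k w b) - a (f_after k b w)))"

text \<open>
  \<open>Y\<close> does not depend on the choice of the Kasteleyn orientation \<open>\<phi>\<close>, which is kept as an
  argument.  The expression is meaningful for nonzero weights with \<open>Z k a \<phi> \<noteq> 0\<close>; otherwise the
  convention \<open>x / 0 = 0\<close> applies.
\<close>

definition Y :: "nat \<Rightarrow> (edge \<Rightarrow> 'a::field) \<Rightarrow> (avert \<times> avert \<Rightarrow> int) \<Rightarrow> 'a" where
  "Y k a \<phi> = (\<Prod>f \<in> edges k. a f) * (Z k (\<lambda>f. inverse (a f)) \<phi> / Z k a \<phi>)"

end

theory Submission
  imports Defs "Jordan_Normal_Form.Determinant"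
begin

text \<open>
  The Kasteleyn condition makes every term of \<open>Z\<close> equal, up to one common sign, to the
  corresponding term of the determinant of the matrix \<open>X\<close> with entries \<open>a\<^bsub>f(w,b)\<^esub> - a\<^bsub>f(b,w)\<^esub>\<close>.  When
  the vertical weights are constant along columns, \<open>X\<close> is the composition of a map \<open>L\<close>, which
  treats each level \<open>j = 0, \<dots>, k\<close> of vertices separately, with the difference operator between
  consecutive levels.  The kernel of the latter consists of the vectors that do not depend on the
  level, so \<open>det X\<close> is the determinant of \<open>L\<close> augmented by \<open>k + 1\<close> columns spanning this kernel.
  A cyclic shift of the weights now just permutes the rows and the columns of the augmented matrix,
  and the sign of this permutation is \<open>(-1)\<^sup>k\<close>.
\<close>


section \<open>Rotating the levels in the Aztec determinant\<close>

text \<open>A vertex b(i,j) has vertical edges of equal weight above and below it. So at this vertex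
  the face in column \<open>i\<close> of strip \<open>j\<close> has the entry
  \<open>c i j - d i\<close>, and the face below it, in strip \<open>j - 1\<close>, has
  \<open>d i - c i j\<close>; the faces one column to the right behave likewise. The two strips
  meeting at level \<open>j\<close> thus carry opposite entries, whose common value is
  \<open>bidiag\<close>, and this is what allows \<open>L\<close> to be split off.

  The obstacle to rotating is that there are \<open>k\<close> strips but \<open>k + 1\<close>
  levels: a cyclic shift of levels does not act on the strips. Augmenting replaces strips by levels,
  and the added kernel vectors are themselves invariant under the shift.

  The common sign of the terms comes from a count. Up to signs attached to faces and vertices, every
  Kasteleyn orientation is -1 exactly on the edges from face (i,j) to b(i-1,j+1); for this one the
  inversions of a matching can be counted modulo 2 from its edges, and the result depends only on
  the number of edges going up, which is the same for all matchings.\<close>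

definition bidiag :: "(nat \<Rightarrow> nat \<Rightarrow> 'a::comm_ring_1) \<Rightarrow> (nat \<Rightarrow> 'a) \<Rightarrow> nat \<Rightarrow> nat \<Rightarrow> nat \<Rightarrow> 'a" where
  "bidiag c d j i i' =
     (if i' = i then c i j - d i else if Suc i' = i then d i' - c i j else 0)"

text \<open>
  Row \<open>p\<close> stands for the bounded face in column \<open>p mod (k + 1)\<close> and strip \<open>p div (k + 1)\<close>, and
  column \<open>q\<close> for the vertex \<open>b\<^sub>i\<^sub>,\<^sub>j\<close> with \<open>i = q mod k\<close> and \<open>j = q div k\<close>.
\<close>

definition aztec_mat :: "nat \<Rightarrow> (nat \<Rightarrow> nat \<Rightarrow> 'a::comm_ring_1) \<Rightarrow> (nat \<Rightarrow> 'a) \<Rightarrow> 'a mat" where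
  "aztec_mat k c d = mat (k * Suc k) (k * Suc k) (\<lambda>(p, q).
     if q div k = p div Suc k then bidiag c d (q div k) (p mod Suc k) (q mod k)
     else if q div k = Suc (p div Suc k) then - bidiag c d (q div k) (p mod Suc k) (q mod k)
     else 0)"

text \<open>Rows are grouped by level \<open>r div Suc k\<close>, with the face column
  \<open>r mod Suc k\<close> inside a level. The first \<open>k * Suc k\<close> columns are block
  diagonal (this is \<open>L\<close>); the others are the indicators of the face columns, repeated
  at every level.\<close>

definition aug_mat :: "nat \<Rightarrow> (nat \<Rightarrow> nat \<Rightarrow> 'a::comm_ring_1) \<Rightarrow> (nat \<Rightarrow> 'a) \<Rightarrow> 'a mat" where
  "aug_mat k c d = mat (k * Suc k + Suc k) (k * Suc k + Suc k) (\<lambda>(r, q).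
     if q < k * Suc k
     then if q div k = r div Suc k then bidiag c d (q div k) (r mod Suc k) (q mod k) else 0
     else if r mod Suc k = q - k * Suc k then 1 else 0)"

text \<open>The difference operator between levels, made square by leaving the last \<open>s\<close>
  rows as they are; this also makes it unipotent.\<close>

definition diff_mat :: "nat \<Rightarrow> nat \<Rightarrow> 'a::comm_ring_1 mat" where
  "diff_mat N s = mat N N (\<lambda>(r, t). if t = r then 1 else if t = r + s then - 1 else 0)"

lemma diff_mat_carrier [simp]: "diff_mat N s \<in> carrier_mat N N"
  by (simp add: diff_mat_def)

lemma det_diff_mat:
  assumes "s > 0"
  shows "det (diff_mat N s) = 1"
proof -
  have "upper_triangular (diff_mat N s)"
    using assms by (auto simp: diff_mat_def)
  then have "det (diff_mat N s) = prod_list (diag_mat (diff_mat N s))"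
    using diff_mat_carrier by (rule det_upper_triangular)
  also have "diag_mat (diff_mat N s) = map (\<lambda>_. 1) [0..<N]"
    by (auto simp: diag_mat_def diff_mat_def)
  finally show ?thesis
    by (simp add: map_replicate_const)
qed

lemma diff_mat_mult:
  assumes "A \<in> carrier_mat N m" "r < N" "q < m" "s > 0"
  shows "(diff_mat N s * A) $$ (r, q) = A $$ (r, q) - (if r + s < N then A $$ (r + s, q) else 0)"
proof -
  have "(diff_mat N s * A) $$ (r, q) = (\<Sum>t<N. (if t = r then A $$ (t, q) else 0) -
      (if t = r + s then A $$ (t, q) else 0))"
    using assms
    by (auto simp: diff_mat_def times_mat_def scalar_prod_def lessThan_atLeast0 intro!: sum.cong)
  also have "\<dots> = A $$ (r, q) - (if r + s < N then A $$ (r + s, q) else 0)"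
    using assms by (simp add: sum_subtractf)
  finally show ?thesis .
qed

text \<open>Taking differences of consecutive levels turns the \<open>L\<close> part into the Aztec
  matrix and annihilates the added columns, except in the level left unchanged, where they form an
  identity. The product is block lower triangular, so the block \<open>C\<close> does not affect its
  determinant.\<close>

lemma det_aug_mat:
  fixes c :: "nat \<Rightarrow> nat \<Rightarrow> 'a::idom"
  assumes "k > 0"
  shows "det (aug_mat k c d) = det (aztec_mat k c d)"
proof -
  define n where "n = k * Suc k"
  define C where "C = mat (Suc k) n (\<lambda>(r, q). aug_mat k c d $$ (n + r, q))"
  have A: "aug_mat k c d \<in> carrier_mat (n + Suc k) (n + Suc k)"
    by (simp add: aug_mat_def n_def)
  have div_less: "r div Suc k < k" if "r < n" for r
    using that by (simp add: n_def less_mult_imp_div_less)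
  have "diff_mat (n + Suc k) (Suc k) * aug_mat k c d =
      four_block_mat (aztec_mat k c d) (0\<^sub>m n (Suc k)) C (1\<^sub>m (Suc k))" (is "?L = ?R")
  proof (rule eq_matI)
    fix r q assume "r < dim_row ?R" "q < dim_col ?R"
    then have r: "r < n + Suc k" and q: "q < n + Suc k"
      by (auto simp: aztec_mat_def n_def)
    have L: "?L $$ (r, q) = aug_mat k c d $$ (r, q) -
        (if r < n then aug_mat k c d $$ (r + Suc k, q) else 0)"
      using diff_mat_mult[OF A r q, of "Suc k"] by simp
    have div_add: "(r + Suc k) div Suc k = Suc (r div Suc k)"
      and mod_add: "(r + Suc k) mod Suc k = r mod Suc k"
      by (simp_all add: div_add_self2 del: add_Suc_right)
    have modn: "r mod Suc k = r - n" if "\<not> r < n"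
    proof -
      have "r = (r - n) + k * Suc k" using that by (simp add: n_def)
      then have "r mod Suc k = (r - n) mod Suc k" by (metis mod_mult_self1 mult.commute)
      then show ?thesis using r that by simp
    qed
    show "?L $$ (r, q) = ?R $$ (r, q)"
    proof (cases "r < n")
      case True
      have "r + Suc k < n + Suc k" using True by simp
      then show ?thesis
        unfolding L using True r q
        by (auto simp: aug_mat_def aztec_mat_def n_def[symmetric] div_add mod_add simp del: add_Suc_right mult_Suc_right)
    next
      case False
      then show ?thesis
        unfolding L using r q modn
        by (auto simp: C_def aug_mat_def aztec_mat_def n_def[symmetric] simp del: mult_Suc_right)
    qed
  qed (auto simp: aug_mat_def aztec_mat_def n_def diff_mat_def)
  then have "det (diff_mat (n + Suc k) (Suc k)) * det (aug_mat k c d) = det ?R"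
    using A by (metis det_mult diff_mat_carrier)
  also have "det ?R = det (aztec_mat k c d) * det (1\<^sub>m (Suc k) :: 'a mat)"
    by (rule det_four_block_mat_upper_right_zero) (auto simp: aztec_mat_def n_def C_def)
  finally show ?thesis by (simp add: det_diff_mat)
qed

lemma det_aztec_mat_rotate:
  fixes c c' :: "nat \<Rightarrow> nat \<Rightarrow> 'a::idom"
  assumes k: "k > 0"
    and c': "\<And>i j. i \<le> k \<Longrightarrow> j \<le> k \<Longrightarrow> c' i j = c i (Suc j mod Suc k)"
  shows "det (aztec_mat k c d) = (-1) ^ k * det (aztec_mat k c' d)"
proof -
  define n where "n = k * Suc k"
  have n: "n = k * k + k" by (simp add: n_def)
  let ?A = "aug_mat k c d"
  have A: "?A \<in> carrier_mat (n + Suc k) (n + Suc k)"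
    by (simp add: aug_mat_def n_def)
  define B where "B = mat (n + Suc k) (n + Suc k)
    (\<lambda>(i, j). ?A $$ (if i < n then i + Suc k else i - n, j))"
  have B: "B \<in> carrier_mat (n + Suc k) (n + Suc k)"
    by (simp add: B_def)
  \<comment> \<open>Moving the first level of rows behind the \<open>n\<close> others has the sign
    of exponent \<open>n * Suc k\<close>, which is even because
    \<open>n = k * Suc k\<close>.\<close>
  have detA: "det ?A = det B"
    using det_swap_rows[OF A] by (simp add: B_def n_def power_mult)
  \<comment> \<open>Among the columns only those of level 0, \<open>k\<close> in number, move past
    the \<open>k * k\<close> columns of the other levels; the kernel columns stay in place. This is
    the source of \<open>(-1) ^ k\<close>.\<close>
  have detB: "det B = (-1) ^ (k * (k * k)) * det (mat (n + Suc k) (n + Suc k)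
     (\<lambda>(i, j). B $$ (i, if j < k * k then j + k else if j < k + k * k then j - k * k else j)))"
    by (rule det_swap_initial_cols[OF B]) (simp add: n)
  have "mat (n + Suc k) (n + Suc k)
     (\<lambda>(i, j). B $$ (i, if j < k * k then j + k else if j < k + k * k then j - k * k else j)) =
     aug_mat k c' d" (is "?L = ?R")
  proof (rule eq_matI)
    fix r q assume "r < dim_row ?R" "q < dim_col ?R"
    then have r: "r < n + Suc k" and q: "q < n + Suc k"
      by (auto simp: aug_mat_def n_def)
    \<comment> \<open>The row and column of \<open>?A\<close> from which the entry
      \<open>(r, q)\<close> is taken. Both lie one level higher, cyclically, at the same position
      within the level.\<close>
    define \<rho> where "\<rho> = (if r < n then r + Suc k else r - n)"
    define \<kappa> where "\<kappa> = (if q < k * k then q + k else if q < k + k * k then q - k * k else q)"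
    have L: "?L $$ (r, q) = ?A $$ (\<rho>, \<kappa>)" and \<kappa>: "\<kappa> < n + Suc k" and \<rho>: "\<rho> < n + Suc k"
      using r q by (auto simp: B_def \<rho>_def \<kappa>_def n)
    have q_iff: "\<kappa> < n \<longleftrightarrow> q < n" "\<not> q < n \<Longrightarrow> \<kappa> = q"
      by (auto simp: \<kappa>_def n)
    have \<rho>_mod: "\<rho> mod Suc k = r mod Suc k"
    proof (cases "r < n")
      case False
      then have "r = \<rho> + k * Suc k" by (simp add: n_def \<rho>_def)
      then show ?thesis by (metis mod_mult_self1 mult.commute)
    qed (simp add: \<rho>_def del: add_Suc_right)
    have \<rho>_div: "\<rho> div Suc k = Suc (r div Suc k) mod Suc k"
    proof (cases "r < n")
      case True
      then have "r div Suc k < k" by (simp add: n_def less_mult_imp_div_less)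
      then show ?thesis using True by (simp add: \<rho>_def div_add_self2 del: add_Suc_right)
    next
      case False
      then have "r = \<rho> + k * Suc k" "\<rho> < Suc k" using r by (simp_all add: n_def \<rho>_def)
      then have "r div Suc k = k"
        by (metis add.commute add_0 div_less div_mult_self2 mult.commute nat.distinct(1))
      with \<open>\<rho> < Suc k\<close> show ?thesis by simp
    qed
    have \<kappa>_mod: "\<kappa> mod k = q mod k" if "q < n"
    proof (cases "q < k * k")
      case False
      then have "q = \<kappa> + k * k" using that by (simp add: n \<kappa>_def)
      then show ?thesis by (metis mod_mult_self1 mult.commute)
    qed (simp add: \<kappa>_def)
    have \<kappa>_div: "\<kappa> div k = Suc (q div k) mod Suc k" if "q < n"
    proof (cases "q < k * k")
      case True
      then have "q div k < k" by (simp add: less_mult_imp_div_less)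
      then show ?thesis using True k by (simp add: \<kappa>_def div_add_self2)
    next
      case False
      then have *: "q = \<kappa> + k * k" "\<kappa> < k" using that by (simp_all add: n \<kappa>_def)
      then have "q div k = k" using k by simp
      with * show ?thesis by simp
    qed
    have r_div: "r div Suc k \<le> k"
      using r by (metis n_def add.commute less_mult_imp_div_less mult_Suc less_Suc_eq_le)
    have q_div: "q div k \<le> k" if "q < n"
      using that less_mult_imp_div_less[of q "Suc k" k] by (simp add: n_def mult.commute)
    \<comment> \<open>The shift is injective on levels, so the block diagonal pattern is
      preserved.\<close>
    have eq_iff: "Suc x mod Suc k = Suc y mod Suc k \<longleftrightarrow> x = y" if "x \<le> k" "y \<le> k" for x y
      using that by (auto simp: mod_Suc split: if_splits)
    have "\<And>i. i \<le> k \<Longrightarrow> bidiag c d (Suc (q div k) mod Suc k) i (q mod k) = bidiag c' d (q div k) i (q mod k)"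
      if "q < n" using that q_div c' by (simp add: bidiag_def)
    then show "?L $$ (r, q) = ?R $$ (r, q)"
      unfolding L using r q \<rho> \<kappa> q_iff r_div q_div eq_iff
      by (auto simp: aug_mat_def n_def[symmetric] \<rho>_mod \<rho>_div \<kappa>_mod \<kappa>_div simp del: mult_Suc_right)
  qed (auto simp: aug_mat_def n_def)
  moreover have "(-1 :: 'a) ^ (k * (k * k)) = (-1) ^ k"
    by (cases "even k") (auto simp: power_mult)
  ultimately show ?thesis
    using detA detB det_aug_mat[OF k] by metis
qed

section \<open>Signs of matchings\<close>

definition inversions :: "nat \<Rightarrow> (nat \<Rightarrow> nat) \<Rightarrow> (nat \<times> nat) set" where
  "inversions n \<sigma> = {(i, j). i < j \<and> j < n \<and> \<sigma> j < \<sigma> i}"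

lemma finite_less_pairs: "finite {(i, j). i < j \<and> j < (n :: nat)}"
  by (rule finite_subset[of _ "{..<n} \<times> {..<n}"]) auto

lemma minus_one_power_card_filter:
  assumes "finite A"
  shows "(\<Prod>x\<in>A. if P x then - 1 else 1 :: 'a::comm_ring_1) = (-1) ^ card {x \<in> A. P x}"
  using assms by (simp add: prod.If_cases Int_def)

lemma minus_one_power_card_inversions:
  "(-1 :: int) ^ card (inversions n \<sigma>) =
     (\<Prod>(i, j) \<in> {(i, j). i < j \<and> j < n}. if \<sigma> j < \<sigma> i then - 1 else 1)"
  using minus_one_power_card_filter[OF finite_less_pairs[of n],
      of "\<lambda>(i, j). \<sigma> j < \<sigma> i", where ?'a = int]
  by (simp add: inversions_def case_prod_unfold conj_assoc)

text \<open>A pair is inverted by \<sigma> \<circ> \<tau> iff exactly one of two things happens: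
  \<tau> inverts it, or \<sigma> inverts its image under \<tau> put into increasing order. Taking
  sorted images permutes the increasing pairs, so the product over them splits.\<close>

lemma inversions_comp:
  assumes \<sigma>: "\<sigma> permutes {0..<n}" and \<tau>: "\<tau> permutes {0..<n}"
  shows "(-1 :: int) ^ card (inversions n (\<sigma> \<circ> \<tau>)) =
     (-1) ^ card (inversions n \<sigma>) * (-1) ^ card (inversions n \<tau>)"
proof -
  let ?P = "{(i, j). i < j \<and> j < n}"
  let ?s = "\<lambda>\<tau> (i, j). (min (\<tau> i) (\<tau> j), max (\<tau> i) (\<tau> j) :: nat)"
  let ?h = "\<lambda>\<sigma> (i, j). if \<sigma> j < \<sigma> i then - 1 else 1 :: int"
  have inv: "Hilbert_Choice.inv \<tau> permutes {0..<n}" using \<tau> by (rule permutes_inv)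
  have lt: "\<rho> i < n" if "\<rho> permutes {0..<n}" "i < n" for \<rho> i
    using permutes_in_image[OF that(1), of i] that(2) by simp
  have eq: "\<rho> i = \<rho> j \<longleftrightarrow> i = j" if "\<rho> permutes {0..<n}" for \<rho> i j
    using permutes_inj[OF that] by (simp add: inj_eq)
  have mem: "?s \<rho> x \<in> ?P" if "\<rho> permutes {0..<n}" "x \<in> ?P" for \<rho> x
  proof -
    obtain i j where "x = (i, j)" "i < j" "j < n" using \<open>x \<in> ?P\<close> by auto
    moreover from this have "\<rho> i \<noteq> \<rho> j" "\<rho> i < n" "\<rho> j < n"
      using eq[OF that(1)] lt[OF that(1)] by auto
    ultimately show ?thesis by auto
  qed
  have cancel: "?s \<rho>' (?s \<rho> x) = x" if "\<And>y. \<rho>' (\<rho> y) = y" "x \<in> ?P" for \<rho>' \<rho> x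
    using that by (auto simp: min_def max_def)
  have "(\<Prod>x\<in>?P. ?h \<sigma> (?s \<tau> x)) = (\<Prod>x\<in>?P. ?h \<sigma> x)"
    using mem[OF \<tau>] mem[OF inv] cancel[of "Hilbert_Choice.inv \<tau>" \<tau>] cancel[of \<tau> "Hilbert_Choice.inv \<tau>"]
    by (intro prod.reindex_bij_witness[of _ "?s (Hilbert_Choice.inv \<tau>)" "?s \<tau>"])
      (simp_all add: permutes_inverses[OF \<tau>])
  moreover have "(\<Prod>x\<in>?P. ?h (\<sigma> \<circ> \<tau>) x) =
      (\<Prod>x\<in>?P. ?h \<sigma> (?s \<tau> x) * ?h \<tau> x)"
  proof (rule prod.cong)
    fix x assume "x \<in> ?P"
    then obtain i j where x: "x = (i, j)" "i < j" "j < n" by auto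
    then have "\<tau> i \<noteq> \<tau> j" "\<sigma> (\<tau> i) \<noteq> \<sigma> (\<tau> j)" by (auto simp: eq[OF \<tau>] eq[OF \<sigma>])
    then show "?h (\<sigma> \<circ> \<tau>) x =
        ?h \<sigma> (?s \<tau> x) * ?h \<tau> x"
      by (auto simp: x min_def max_def)
  qed simp
  ultimately show ?thesis
    unfolding minus_one_power_card_inversions by (simp add: prod.distrib)
qed

text \<open>Both sides are multiplicative, and exchanging a < b creates 2(b - a) - 1 inversions, an
  odd number.\<close>

lemma sign_inversions:
  assumes "\<sigma> permutes {0..<n}"
  shows "sign \<sigma> = (-1) ^ card (inversions n \<sigma>)"
  using assms finite_atLeastLessThan[of 0 n]
proof (induction rule: permutes_induct)
  case id
  have "inversions n id = {}" by (auto simp: inversions_def)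
  then show ?case by (simp only: sign_id) simp
next
  case (swap a b p)
  have trans: "(-1 :: int) ^ card (inversions n (transpose a b)) = - 1" if "a < b" "b < n" for a b
  proof -
    have "inversions n (transpose a b) = Pair a ` {a<..b} \<union> (\<lambda>i. (i, b)) ` {a<..<b}"
      using that by (auto simp: inversions_def transpose_def split: if_splits)
    moreover have "card (Pair a ` {a<..b} \<union> (\<lambda>i. (i, b)) ` {a<..<b}) =
        card (Pair a ` {a<..b}) + card ((\<lambda>i. (i, b)) ` {a<..<b})"
      by (rule card_Un_disjoint) auto
    moreover have "\<dots> = (b - a) + (b - Suc a)"
      by (simp add: card_image inj_on_def)
    moreover have "(b - a) + (b - Suc a) = Suc (2 * (b - Suc a))" using that by simp
    ultimately show ?thesis by simp
  qed
  have tr: "(-1 :: int) ^ card (inversions n (transpose a b)) = - 1"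
    using trans[of a b] trans[of b a] swap by (cases "a < b") (auto simp: transpose_commute)
  have tp: "transpose a b permutes {0..<n}" using swap by (simp add: permutes_swap_id)
  have "sign (transpose a b \<circ> p) = sign (transpose a b) * sign p"
    using permutation_permutes swap by (intro sign_compose permutation_swap_id) blast
  also have "\<dots> = (-1) ^ card (inversions n (transpose a b)) * (-1) ^ card (inversions n p)"
    using swap tr by (simp add: sign_swap_id)
  also have "\<dots> = (-1) ^ card (inversions n (transpose a b \<circ> p))"
    using tp swap by (intro inversions_comp[symmetric])
  finally show ?case .
qed

section \<open>Inversions of a permutation that follows edges of the Aztec diamond\<close>

lemma card_row_less:
  fixes m :: nat
  assumes "r < N * m"
  shows "card {q. q < N * m \<and> q div m = r div m \<and> q < r} = r mod m"
proof -
  have m: "m > 0" using assms by (cases m) auto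
  have "{q. q < N * m \<and> q div m = r div m \<and> q < r} = {r div m * m..<r}"
  proof (intro Set.set_eqI iffI)
    fix q assume "q \<in> {q. q < N * m \<and> q div m = r div m \<and> q < r}"
    then have "q div m = r div m" "q < r" by auto
    moreover from this have "r div m * m \<le> q" by (metis div_times_less_eq_dividend)
    ultimately show "q \<in> {r div m * m..<r}" by simp
  next
    fix q assume "q \<in> {r div m * m..<r}"
    then have "r div m * m \<le> q" "q < r" by auto
    then have "q div m = r div m"
      using m by (metis div_le_mono le_antisym less_imp_le_nat nonzero_mult_div_cancel_right not_gr_zero)
    then show "q \<in> {q. q < N * m \<and> q div m = r div m \<and> q < r}"
      using \<open>q < r\<close> assms by simp
  qed
  then show ?thesis by (simp add: minus_div_mult_eq_mod)
qed

lemma card_row_greater: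
  fixes m :: nat
  assumes "r < N * m"
  shows "card {q. q < N * m \<and> q div m = r div m \<and> r < q} = m - Suc (r mod m)"
proof -
  have m: "m > 0" using assms by (cases m) auto
  have rN: "r div m < N" using assms by (simp add: less_mult_imp_div_less)
  have eq: "Suc (r div m) * m = r - r mod m + m"
    by (simp add: minus_mod_eq_div_mult)
  have "{q. q < N * m \<and> q div m = r div m \<and> r < q} = {r<..<Suc (r div m) * m}"
  proof (intro Set.set_eqI iffI)
    fix q assume "q \<in> {q. q < N * m \<and> q div m = r div m \<and> r < q}"
    then have "q div m = r div m" "r < q" by auto
    moreover from this have "q < Suc (r div m) * m" using m by (metis dividend_less_div_times mult_Suc)
    ultimately show "q \<in> {r<..<Suc (r div m) * m}" by simp
  next
    fix q assume "q \<in> {r<..<Suc (r div m) * m}"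
    then have "r < q" "q < Suc (r div m) * m" by auto
    then have "q div m = r div m"
      by (metis div_le_mono le_antisym less_Suc_eq_le less_imp_le_nat less_mult_imp_div_less)
    moreover have "Suc (r div m) * m \<le> N * m" using rN by (intro mult_le_mono1) simp
    ultimately show "q \<in> {q. q < N * m \<and> q div m = r div m \<and> r < q}"
      using \<open>r < q\<close> \<open>q < Suc (r div m) * m\<close> by simp
  qed
  then have "card {q. q < N * m \<and> q div m = r div m \<and> r < q} = Suc (r div m) * m - Suc r" by simp
  also have "\<dots> = m - Suc (r mod m)"
    using eq mod_less_eq_dividend[of r m] mod_less_divisor[OF m, of r] by linarith
  finally show ?thesis .
qed

text \<open>
  The index of a face or vertex is ordered first by its row (the quotient).  An inversion then
  pairs an element \<open>p\<close> matched to the upper row with an element matched to the lower row, either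
  in the row of \<open>p\<close> or in that of \<open>\<sigma> p\<close>.  Adding the pairs of elements that are both matched
  upwards, once on each side, makes both counts explicit.
\<close>

lemma sign_aztec:
  assumes k: "k > 0" and n: "n = k * Suc k" and \<sigma>: "\<sigma> permutes {0..<n}"
    and row: "\<And>p. p < n \<Longrightarrow> \<sigma> p div k = p div Suc k \<or> \<sigma> p div k = Suc (p div Suc k)"
    and col: "\<And>p. p < n \<Longrightarrow> \<sigma> p mod k = p mod Suc k \<or> Suc (\<sigma> p mod k) = p mod Suc k"
  shows "sign \<sigma> * (\<Prod>p<n. if \<sigma> p div k = Suc (p div Suc k) \<and> Suc (\<sigma> p mod k) = p mod Suc k then - 1 else 1) =
    (-1) ^ (k * ((\<Sum>q<n. q div k) - (\<Sum>p<n. p div Suc k)))"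
proof -
  have n': "n = Suc k * k" by (simp add: n)
  define up where "up p \<longleftrightarrow> \<sigma> p div k = Suc (p div Suc k)" for p
  define U where "U = {p. p < n \<and> up p}"
  define I1 where "I1 = {(p, q). p \<in> U \<and> q < n \<and> \<not> up q \<and> q div Suc k = p div Suc k \<and> p < q}"
  define I2 where "I2 = {(p, q). p \<in> U \<and> q < n \<and> \<not> up q \<and> \<sigma> q div k = \<sigma> p div k \<and> \<sigma> q < \<sigma> p}"
  define Q1 where "Q1 = {(p, q). p \<in> U \<and> q \<in> U \<and> q div Suc k = p div Suc k \<and> p < q}"
  define Q2 where "Q2 = {(p, q). p \<in> U \<and> q \<in> U \<and> \<sigma> q div k = \<sigma> p div k \<and> \<sigma> q < \<sigma> p}"
  have row_down: "\<sigma> p div k = p div Suc k" if "p < n" "\<not> up p" for p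
    using row[OF that(1)] that(2) by (simp add: up_def)
  have row_up: "\<sigma> p div k = Suc (p div Suc k)" if "up p" for p
    using that by (simp add: up_def)
  have fin: "finite U" "finite I1" "finite I2" "finite Q1" "finite Q2"
    by (auto simp: U_def I1_def I2_def Q1_def Q2_def intro: finite_subset[of _ "{..<n} \<times> {..<n}"])
  have lt: "\<sigma> p < n" if "p < n" for p
    using permutes_in_image[OF \<sigma>, of p] that by simp
  have eq: "\<sigma> p = \<sigma> q \<longleftrightarrow> p = q" for p q
    using permutes_inj[OF \<sigma>] by (simp add: inj_eq)
  have less_row: "x < y" if "x div m < y div m" for x y m :: nat
    using that by (metis div_le_mono linorder_not_le)
  have less_col: "x < y \<longleftrightarrow> x mod m < y mod m" if "x div m = y div m" for x y m :: nat
    using that by (metis div_mult_mod_eq nat_add_left_cancel_less)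
  \<comment> \<open>Edges leaving one row in the same direction do not cross: the column index stays
    or drops by one, so the order is kept weakly, and injectivity makes it strict.\<close>
  have mono: "\<sigma> p < \<sigma> q" if "p < q" "q < n" "p div Suc k = q div Suc k" "up p = up q" for p q
  proof -
    have p: "p < n" using that by simp
    have "\<sigma> p div k = \<sigma> q div k"
      using row_up[of p] row_up[of q] row_down[OF p] row_down[OF that(2)] that by metis
    moreover have "\<sigma> p mod k \<le> \<sigma> q mod k"
      using col[OF p] col[OF that(2)] less_col[OF that(3)] that(1) by linarith
    ultimately have "\<sigma> p \<le> \<sigma> q"
      by (metis div_mult_mod_eq nat_add_left_cancel_le)
    then show ?thesis using eq[of p q] that(1) by linarith
  qed
  have inv: "inversions n \<sigma> = I1 \<union> I2"
  proof (intro Set.set_eqI iffI)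
    fix x assume "x \<in> inversions n \<sigma>"
    then obtain p q where x: "x = (p, q)" "p < q" "q < n" "\<sigma> q < \<sigma> p"
      by (auto simp: inversions_def)
    have p: "p < n" using x by simp
    have le: "p div Suc k \<le> q div Suc k" using x by (intro div_le_mono) simp
    have le': "\<sigma> q div k \<le> \<sigma> p div k" using x by (intro div_le_mono) simp
    \<comment> \<open>With equal directions an inversion would force \<open>p\<close> and
      \<open>q\<close> into one row, against \<open>mono\<close>. If only \<open>q\<close> went up,
      then \<sigma> q would lie in a higher row than \<sigma> p.\<close>
    have "up p \<noteq> up q"
    proof
      assume same: "up p = up q"
      then have "q div Suc k \<le> p div Suc k"
        using le' row_up[of p] row_up[of q] row_down[OF p] row_down[OF x(3)] by (cases "up p") auto
      then show False using mono[OF x(2,3)] same le x(4) by simp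
    qed
    moreover have "\<not> up q"
      using calculation le le' row_up[of q] row_down[OF p] by auto
    ultimately have up: "up p" "\<not> up q" by auto
    then consider "q div Suc k = p div Suc k" | "q div Suc k = Suc (p div Suc k)"
      using le le' row_up[of p] row_down[OF x(3)] by linarith
    then show "x \<in> I1 \<union> I2"
      by cases (use x p up row_up[of p] row_down[OF x(3)] in \<open>auto simp: I1_def I2_def U_def\<close>)
  next
    fix x assume "x \<in> I1 \<union> I2"
    then show "x \<in> inversions n \<sigma>"
    proof
      assume "x \<in> I1"
      then obtain p q where x: "x = (p, q)" "up p" "q < n" "\<not> up q" "q div Suc k = p div Suc k" "p < q"
        by (auto simp: I1_def U_def)
      then have "\<sigma> q div k < \<sigma> p div k" by (simp add: row_up row_down)
      then have "\<sigma> q < \<sigma> p" by (rule less_row)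
      then show ?thesis using x by (simp add: inversions_def)
    next
      assume "x \<in> I2"
      then obtain p q where x: "x = (p, q)" "p < n" "up p" "q < n" "\<not> up q" "\<sigma> q div k = \<sigma> p div k" "\<sigma> q < \<sigma> p"
        by (auto simp: I2_def U_def)
      then have "p div Suc k < q div Suc k" by (simp add: row_up row_down)
      then have "p < q" by (rule less_row)
      then show ?thesis using x by (simp add: inversions_def)
    qed
  qed
  have disj: "I1 \<inter> I2 = {}"
    by (auto simp: I1_def I2_def U_def row_up row_down)
  \<comment> \<open>Two upward edges from one row end in one row in the same order.
    \<open>Q1\<close> lists such a pair with its left element first, \<open>Q2\<close> with its
    right element first.\<close>
  have "Q2 = prod.swap ` Q1"
  proof (intro Set.set_eqI iffI)
    fix x assume "x \<in> Q2"
    then obtain p q where x: "x = (p, q)" "p \<in> U" "q \<in> U" "\<sigma> q div k = \<sigma> p div k" "\<sigma> q < \<sigma> p"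
      by (auto simp: Q2_def)
    then have *: "q div Suc k = p div Suc k" "up p" "up q" "p < n" by (auto simp: U_def up_def)
    with x mono[of p q] have "q < p" by (metis (no_types, lifting) U_def linorder_neqE_nat mem_Collect_eq order_less_asym less_irrefl)
    with x * show "x \<in> prod.swap ` Q1" by (auto simp: Q1_def image_iff)
  next
    fix x assume "x \<in> prod.swap ` Q1"
    then obtain p q where x: "x = (q, p)" "p \<in> U" "q \<in> U" "q div Suc k = p div Suc k" "p < q"
      by (auto simp: Q1_def)
    then have "\<sigma> p < \<sigma> q" "\<sigma> q div k = \<sigma> p div k" using mono[of p q] by (auto simp: U_def row_up)
    with x show "x \<in> Q2" by (auto simp: Q2_def)
  qed
  then have Q: "card Q2 = card Q1"
    by (simp only: card_image[OF inj_on_subset[OF inj_swap subset_UNIV]])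
  have c1: "card I1 + card Q1 = (\<Sum>p\<in>U. k - p mod Suc k)"
  proof -
    have "card I1 + card Q1 = card (I1 \<union> Q1)"
      using fin by (intro card_Un_disjoint[symmetric]) (auto simp: I1_def Q1_def U_def)
    also have "I1 \<union> Q1 = (SIGMA p:U. {q. q < k * Suc k \<and> q div Suc k = p div Suc k \<and> p < q})"
      by (auto simp: I1_def Q1_def U_def n)
    also have "card \<dots> = (\<Sum>p\<in>U. card {q. q < k * Suc k \<and> q div Suc k = p div Suc k \<and> p < q})"
      using fin by (intro card_SigmaI) (auto intro: finite_subset[of _ "{..<n}"] simp: n)
    also have "\<dots> = (\<Sum>p\<in>U. k - p mod Suc k)"
      by (intro sum.cong refl) (simp only: U_def n mem_Collect_eq card_row_greater diff_Suc_Suc)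
    finally show ?thesis .
  qed
  have c2: "card I2 + card Q2 = (\<Sum>p\<in>U. \<sigma> p mod k)"
  proof -
    have "card I2 + card Q2 = card (I2 \<union> Q2)"
      using fin by (intro card_Un_disjoint[symmetric]) (auto simp: I2_def Q2_def U_def)
    also have "I2 \<union> Q2 = (SIGMA p:U. {q. q < n \<and> \<sigma> q div k = \<sigma> p div k \<and> \<sigma> q < \<sigma> p})"
      by (auto simp: I2_def Q2_def U_def)
    also have "card \<dots> = (\<Sum>p\<in>U. card {q. q < n \<and> \<sigma> q div k = \<sigma> p div k \<and> \<sigma> q < \<sigma> p})"
      using fin by (intro card_SigmaI) (auto intro: finite_subset[of _ "{..<n}"])
    also have "\<dots> = (\<Sum>p\<in>U. \<sigma> p mod k)"
    proof (rule sum.cong)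
      fix p assume "p \<in> U"
      then have p: "\<sigma> p < Suc k * k" using lt by (simp add: U_def n')
      have "bij_betw \<sigma> {q. q < n \<and> \<sigma> q div k = \<sigma> p div k \<and> \<sigma> q < \<sigma> p}
          {q. q < Suc k * k \<and> q div k = \<sigma> p div k \<and> q < \<sigma> p}"
      proof (rule bij_betw_imageI)
        show "inj_on \<sigma> {q. q < n \<and> \<sigma> q div k = \<sigma> p div k \<and> \<sigma> q < \<sigma> p}"
          by (simp add: inj_on_def eq)
        have "\<exists>r. q = \<sigma> r \<and> r < n" if "q < n" for q
          using permutes_image[OF \<sigma>] that by (metis atLeastLessThan_iff imageE zero_le)
        then show "\<sigma> ` {q. q < n \<and> \<sigma> q div k = \<sigma> p div k \<and> \<sigma> q < \<sigma> p} =
            {q. q < Suc k * k \<and> q div k = \<sigma> p div k \<and> q < \<sigma> p}"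
          using lt unfolding n'[symmetric] by fastforce
      qed
      from bij_betw_same_card[OF this]
      show "card {q. q < n \<and> \<sigma> q div k = \<sigma> p div k \<and> \<sigma> q < \<sigma> p} = \<sigma> p mod k"
        by (simp only: card_row_less[OF p])
    qed simp
    finally show ?thesis .
  qed
  \<comment> \<open>If face column i is matched to vertex column i', then p contributes (k - i) +
    i', which is k when i' = i and k - 1 when i' = i - 1. The set \<open>V\<close> makes up for the
    missing ones.\<close>
  define V where "V = {p \<in> U. Suc (\<sigma> p mod k) = p mod Suc k}"
  have "(\<Sum>p\<in>U. k - p mod Suc k) + (\<Sum>p\<in>U. \<sigma> p mod k) + card V =
      (\<Sum>p\<in>U. (k - p mod Suc k) + \<sigma> p mod k + (if Suc (\<sigma> p mod k) = p mod Suc k then 1 else 0))"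
    using fin by (simp only: sum.distrib) (simp add: V_def sum.If_cases Int_def)
  also have "\<dots> = (\<Sum>p\<in>U. k)"
  proof (rule sum.cong)
    fix p assume "p \<in> U"
    then have p: "p < n" by (simp add: U_def)
    have le: "p mod Suc k \<le> k" by (simp add: less_Suc_eq_le[symmetric])
    show "(k - p mod Suc k) + \<sigma> p mod k + (if Suc (\<sigma> p mod k) = p mod Suc k then 1 else 0) = k"
    proof (cases "Suc (\<sigma> p mod k) = p mod Suc k")
      case True
      then show ?thesis using le by (subst if_P[OF True]) linarith
    next
      case False
      then show ?thesis using le col[OF p] by (subst if_not_P[OF False]) linarith
    qed
  qed simp
  finally have "card (inversions n \<sigma>) + 2 * card Q1 + card V = k * card U"
    using c1 c2 Q disj fin by (simp add: inv card_Un_disjoint mult.commute[of _ k] del: Nat.add_diff_assoc)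
  then have "k * card U = card (inversions n \<sigma>) + card V + 2 * card Q1"
    by (simp only: add_ac)
  then have "even (card (inversions n \<sigma>) + card V) = even (k * card U)"
    by (simp only: even_add) simp
  then have "(-1 :: int) ^ (card (inversions n \<sigma>) + card V) = (-1) ^ (k * card U)"
    by (simp add: uminus_power_if)
  moreover have "(\<Prod>p<n. if \<sigma> p div k = Suc (p div Suc k) \<and> Suc (\<sigma> p mod k) = p mod Suc k then - 1 else 1) =
      (-1 :: int) ^ card V"
    unfolding minus_one_power_card_filter[OF finite_lessThan]
    by (rule arg_cong[where f = "\<lambda>A. (-1) ^ card A"]) (auto simp: V_def U_def up_def)
  \<comment> \<open>Each upward edge raises the row index by one, so the number of such edges is the
    difference of the two row totals, whatever \<sigma> is.\<close>
  moreover have "(\<Sum>q<n. q div k) = (\<Sum>p<n. p div Suc k) + card U"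
  proof -
    have "(\<Sum>q<n. q div k) = (\<Sum>p<n. \<sigma> p div k)"
      using sum.permute[OF \<sigma>, of "\<lambda>q. q div k"] by (simp add: lessThan_atLeast0 o_def)
    also have "\<dots> = (\<Sum>p<n. p div Suc k + (if up p then 1 else 0))"
      by (intro sum.cong) (auto simp: row_up row_down)
    also have "\<dots> = (\<Sum>p<n. p div Suc k) + card U"
      by (simp add: sum.distrib sum.If_cases U_def Int_def)
    finally show ?thesis .
  qed
  ultimately show ?thesis
    using sign_inversions[OF \<sigma>] by (simp add: power_add)
qed

section \<open>The faces of the graph\<close>

lemma cyclic_pred_nth:
  assumes "distinct xs" "n < length xs"
  shows "cyclic_pred xs (xs ! (Suc n mod length xs)) = xs ! n"
  unfolding cyclic_pred_def
proof (rule the_equality)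
  have "xs \<noteq> []" using assms by auto
  fix y assume "\<exists>m<length xs. xs ! m = y \<and> xs ! (Suc m mod length xs) = xs ! (Suc n mod length xs)"
  then obtain m where m: "m < length xs" "xs ! m = y"
    "xs ! (Suc m mod length xs) = xs ! (Suc n mod length xs)" by blast
  then have "Suc m mod length xs = Suc n mod length xs"
    using assms \<open>xs \<noteq> []\<close> by (subst (asm) nth_eq_iff_index_eq) auto
  then have "m = n" using m(1) assms(2) by (auto simp: mod_Suc split: if_splits)
  then show "y = xs ! n" using m by simp
qed (use assms in auto)

lemma cyclic_pred_hd:
  assumes "distinct (x # xs)"
  shows "cyclic_pred (x # xs) x = last (x # xs)"
  using cyclic_pred_nth[OF assms, of "length xs"] by (simp add: last_conv_nth)

lemma cyclic_pred_append:
  assumes "distinct (ys @ y # x # zs)"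
  shows "cyclic_pred (ys @ y # x # zs) x = y"
  using cyclic_pred_nth[OF assms, of "length ys"] by (simp add: nth_append)

text \<open>Together these cover every position in a list of at most four neighbours, the largest
  degree apart from \<open>BL\<close> and \<open>BR\<close>.\<close>

lemmas cyclic_pred_simps =
  cyclic_pred_hd cyclic_pred_append[of "[]", simplified]
  cyclic_pred_append[of "[a]" for a, simplified] cyclic_pred_append[of "[a, b]" for a b, simplified]

lemma cyclic_on_3:
  assumes "f a = b" "f b = c" "f c = a"
  shows "cyclic_on f {a, b, c}"
proof -
  have "orbit f a = {(f ^^ m) a | m. m < 3}"
    by (rule orbit_altdef_bounded) (simp_all add: assms numeral_3_eq_3)
  also have "\<dots> = {a, b, c}"
    using assms by (auto simp: numeral_3_eq_3 less_Suc_eq ex_disj_distrib conj_disj_distribL)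
  finally show ?thesis by (auto simp: cyclic_on_def)
qed

lemma cyclic_on_4:
  assumes "f a = b" "f b = c" "f c = d" "f d = a"
  shows "cyclic_on f {a, b, c, d}"
proof -
  have "orbit f a = {(f ^^ m) a | m. m < 4}"
    by (rule orbit_altdef_bounded) (simp_all add: assms eval_nat_numeral)
  also have "\<dots> = {a, b, c, d}"
    using assms by (auto simp: eval_nat_numeral less_Suc_eq ex_disj_distrib conj_disj_distribL)
  finally show ?thesis by (auto simp: cyclic_on_def)
qed

section \<open>Darts and faces of the grid graph\<close>

definition east :: "nat \<Rightarrow> nat \<Rightarrow> nat \<Rightarrow> vert \<times> vert" where
  "east k i j = (left_end i j, right_end k i j)"

definition west :: "nat \<Rightarrow> nat \<Rightarrow> nat \<Rightarrow> vert \<times> vert" where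
  "west k i j = (right_end k i j, left_end i j)"

definition north :: "nat \<Rightarrow> nat \<Rightarrow> vert \<times> vert" where
  "north i j = (BV i j, BV i (Suc j))"

definition south :: "nat \<Rightarrow> nat \<Rightarrow> vert \<times> vert" where
  "south i j = (BV i (Suc j), BV i j)"

text \<open>The face bounded by \<open>e\<^sub>i\<^sub>,\<^sub>j\<close>, \<open>g\<^sub>i\<^sub>,\<^sub>j\<close>, \<open>e\<^sub>i\<^sub>,\<^sub>j\<^sub>+\<^sub>1\<close> and \<open>g\<^sub>i\<^sub>-\<^sub>1\<^sub>,\<^sub>j\<close>, those that exist.\<close>

definition white :: "nat \<Rightarrow> nat \<Rightarrow> nat \<Rightarrow> face" where
  "white k i j = {east k i j, west k i (Suc j)} \<union>
     (if i < k then {north i j} else {}) \<union> (if 0 < i then {south (i - 1) j} else {})"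

lemmas dart_defs = east_def west_def north_def south_def left_end_def right_end_def

lemma cyclic_pred_BL:
  assumes "j \<le> k"
  shows "cyclic_pred (rot_G k BL) (BV 0 j) = BV 0 (if j = 0 then k else j - 1)"
proof -
  have *: "distinct (rot_G k BL)" "length (rot_G k BL) = Suc k"
    by (simp_all add: distinct_map inj_on_def image_iff)
  have nth: "rot_G k BL ! n = BV 0 n" if "n \<le> k" for n
    using that by (simp add: nth_map_upt del: upt_Suc)
  show ?thesis
    using cyclic_pred_nth[OF *(1), of "if j = 0 then k else j - 1"] assms
    unfolding *(2) by (auto simp: nth simp del: rot_G.simps)
qed

lemma cyclic_pred_BR:
  assumes "j \<le> k"
  shows "cyclic_pred (rot_G k BR) (BV (k - 1) j) = BV (k - 1) (if j = k then 0 else Suc j)"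
proof -
  have *: "distinct (rot_G k BR)" "length (rot_G k BR) = Suc k"
    by (simp_all add: distinct_map inj_on_def image_iff)
  have nth: "rot_G k BR ! n = BV (k - 1) (k - n)" if "n \<le> k" for n
    using that by (simp add: rev_nth nth_append del: upt_Suc)
  show ?thesis
    using cyclic_pred_nth[OF *(1), of "if j = k then k else k - Suc j"] assms
    unfolding *(2) by (auto simp: nth Suc_diff_Suc simp del: rot_G.simps)
qed

text \<open>The case \<open>j = k\<close> runs along the top of the graph and turns back at
  \<open>BR\<close>; it belongs to the outer face. For \<open>j < k\<close> the step follows the
  bounded face above the dart.\<close>

lemma face_step_east:
  assumes "i \<le> k" "j \<le> k" "k > 0"
  shows "face_step (rot_G k) (east k i j) =
    (if j < k then if i < k then north i j else west k k (Suc j)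
     else if i < k then east k (Suc i) k else west k k 0)"
  using assms cyclic_pred_BR[OF assms(2)]
  by (cases i; cases j) (auto simp: face_step_def dart_defs cyclic_pred_simps simp del: rot_G.simps(1,2))

lemma face_step_west:
  assumes "i \<le> k" "j \<le> k" "k > 0"
  shows "face_step (rot_G k) (west k i j) =
    (if 0 < j then if 0 < i then south (i - 1) (j - 1) else east k 0 (j - 1)
     else if 0 < i then west k (i - 1) 0 else east k 0 k)"
  using assms cyclic_pred_BL[OF assms(2)]
  by (cases i; cases "i - 1"; cases j)
    (auto simp: face_step_def dart_defs cyclic_pred_simps simp del: rot_G.simps(1,2))

lemma face_step_north:
  assumes "i < k" "j < k"
  shows "face_step (rot_G k) (north i j) = west k i (Suc j)"
  using assms
  by (cases i; cases j) (auto simp: face_step_def dart_defs cyclic_pred_simps simp del: rot_G.simps(1,2))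

lemma face_step_south:
  assumes "i < k" "j < k"
  shows "face_step (rot_G k) (south i j) = east k (Suc i) j"
  using assms
  by (cases i; cases j) (auto simp: face_step_def dart_defs cyclic_pred_simps simp del: rot_G.simps(1,2))

lemma cyclic_on_white:
  assumes "i \<le> k" "j < k"
  shows "cyclic_on (face_step (rot_G k)) (white k i j)"
proof -
  note steps = face_step_east face_step_west face_step_north face_step_south
  consider "i = 0" | "i = k" "0 < i" | "0 < i" "i < k" using assms by linarith
  then show ?thesis
  proof cases
    case 1
    then have "white k i j = {east k i j, north i j, west k i (Suc j)}"
      using assms by (auto simp: white_def)
    moreover have "cyclic_on (face_step (rot_G k)) \<dots>"
      using 1 assms by (intro cyclic_on_3) (simp_all add: steps)
    ultimately show ?thesis by simp
  next
    case 2
    then have "white k i j = {east k i j, west k i (Suc j), south (i - 1) j}"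
      using assms by (auto simp: white_def)
    moreover have "cyclic_on (face_step (rot_G k)) \<dots>"
      using 2 assms by (intro cyclic_on_3) (simp_all add: steps)
    ultimately show ?thesis by simp
  next
    case 3
    then have "white k i j = {east k i j, north i j, west k i (Suc j), south (i - 1) j}"
      using assms by (auto simp: white_def)
    moreover have "cyclic_on (face_step (rot_G k)) \<dots>"
      using 3 assms by (intro cyclic_on_4) (simp_all add: steps)
    ultimately show ?thesis by simp
  qed
qed

lemma face_left_white:
  assumes "x \<in> white k i j" "i \<le> k" "j < k"
  shows "face_left (rot_G k) x = white k i j"
  using cyclic_on_white[OF assms(2,3)] assms(1) unfolding face_left_def by (rule orbit_cyclic_eq3)

text \<open>The walk goes along the top to \<open>BR\<close>, back along the bottom to
  \<open>BL\<close>, and closes there. An \<open>orbit\<close> contains its starting point only if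
  the walk returns to it, so membership of \<open>east k 0 k\<close> comes last.\<close>

lemma outer_face_G_members:
  assumes "k > 0" "i \<le> k"
  shows "east k i k \<in> outer_face_G k" "west k i 0 \<in> outer_face_G k"
proof -
  let ?f = "face_step (rot_G k)"
  have start: "outer_face_G k = orbit ?f (east k 0 k)"
    using assms by (simp add: outer_face_G_def face_left_def dart_defs)
  have step: "x \<in> outer_face_G k \<Longrightarrow> ?f x \<in> outer_face_G k" for x
    unfolding start by (rule orbit.step)
  have east: "east k (Suc i) k \<in> outer_face_G k" if "i < k" for i
    using that
  proof (induction i)
    case 0
    then show ?case
      using orbit.base[of ?f "east k 0 k"] by (simp add: start face_step_east)
  next
    case (Suc i)
    then show ?case using step[of "east k (Suc i) k"] by (simp add: face_step_east)
  qed
  have "east k k k \<in> outer_face_G k" using east[of "k - 1"] assms by simp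
  from step[OF this] have "west k k 0 \<in> outer_face_G k" using assms by (simp add: face_step_east)
  then have west: "west k (k - i) 0 \<in> outer_face_G k" if "i \<le> k" for i
    using that
  proof (induction i)
    case (Suc i)
    then show ?case
      using step[of "west k (k - i) 0"] assms by (simp add: face_step_west)
  qed simp
  show "west k i 0 \<in> outer_face_G k" using west[of "k - i"] assms by simp
  have "east k 0 k \<in> outer_face_G k"
    using step[of "west k 0 0"] west[of k] assms by (simp add: face_step_west)
  then show "east k i k \<in> outer_face_G k" using east[of "i - 1"] assms by (cases i) auto
qed

lemma face_left_outer:
  assumes "k > 0" "x \<in> outer_face_G k"
  shows "face_left (rot_G k) x = outer_face_G k"
proof -
  have start: "outer_face_G k = orbit (face_step (rot_G k)) (east k 0 k)"
    using assms by (simp add: outer_face_G_def face_left_def dart_defs)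
  moreover have "east k 0 k \<in> outer_face_G k" using outer_face_G_members assms by blast
  ultimately have "cyclic_on (face_step (rot_G k)) (outer_face_G k)"
    unfolding cyclic_on_def by blast
  then show ?thesis using assms(2) unfolding face_left_def by (rule orbit_cyclic_eq3)
qed

lemma dart_cases:
  assumes "k > 0" "u \<in> verts k" "v \<in> set (rot_G k u)"
  obtains i j where "i \<le> k" "j \<le> k" "(u, v) = east k i j"
  | i j where "i \<le> k" "j \<le> k" "(u, v) = west k i j"
  | i j where "i < k" "j < k" "(u, v) = north i j"
  | i j where "i < k" "j < k" "(u, v) = south i j"
proof (cases u)
  case BL
  then obtain j where "j \<le> k" "v = BV 0 j" using assms by auto
  then show thesis using that(1)[of 0 j] BL assms by (simp add: dart_defs)
next
  case BR
  then obtain j where "j \<le> k" "v = BV (k - 1) j" using assms by auto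
  then show thesis using that(2)[of k j] BR assms by (simp add: dart_defs)
next
  case (BV i j)
  then have ij: "i < k" "j \<le> k" using assms by (auto simp: verts_def blacks_def)
  consider "v = right_end k (Suc i) j" | "v = left_end i j" | "v = BV i (Suc j)" "j < k"
    | "v = BV i (j - 1)" "j > 0"
    using assms(3) BV by (auto split: if_splits)
  then show thesis
  proof cases
    case 1 then show ?thesis using that(1)[of "Suc i" j] ij BV by (simp add: dart_defs)
  next
    case 2 then show ?thesis using that(2)[of i j] ij BV by (simp add: dart_defs)
  next
    case 3 then show ?thesis using that(3)[of i j] ij BV by (simp add: dart_defs)
  next
    case 4 then show ?thesis using that(4)[of i "j - 1"] ij BV by (simp add: dart_defs)
  qed
qed

lemma east_notin_white: "j < k \<Longrightarrow> east k 0 k \<notin> white k i j"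
  by (auto simp: white_def dart_defs split: if_splits)

lemma east_is_dart:
  assumes "k > 0" "i \<le> k" "j \<le> k"
  shows "\<exists>u v. east k i j = (u, v) \<and> u \<in> verts k \<and> v \<in> set (rot_G k u)"
  using assms by (auto simp: dart_defs verts_def blacks_def)

text \<open>A dart off the outer face lies on one of the cycles \<open>white k i j\<close>, since
  the remaining darts all lie on the top or the bottom. Conversely \<open>east k 0 k\<close>
  separates the outer face from these cycles.\<close>

lemma whites_eq:
  assumes "k > 0"
  shows "whites k = {white k i j | i j. i \<le> k \<and> j < k}"
proof (intro Set.equalityI subsetI)
  fix w assume "w \<in> whites k"
  then obtain u v where uv: "u \<in> verts k" "v \<in> set (rot_G k u)" "w = face_left (rot_G k) (u, v)"
    and outer: "w \<noteq> outer_face_G k"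
    by (auto simp: whites_def faces_def)
  from outer have notin: "(u, v) \<notin> outer_face_G k"
    using face_left_outer[OF assms] uv(3) by blast
  from assms uv(1,2) have "\<exists>i j. i \<le> k \<and> j < k \<and> (u, v) \<in> white k i j"
  proof (cases rule: dart_cases)
    case (1 i j)
    then have "j \<noteq> k" using notin outer_face_G_members assms by metis
    with 1 show ?thesis by (intro exI[of _ i] exI[of _ j]) (simp add: white_def)
  next
    case (2 i j)
    then have "j \<noteq> 0" using notin outer_face_G_members assms by metis
    with 2 show ?thesis by (intro exI[of _ i] exI[of _ "j - 1"]) (simp add: white_def)
  next
    case (3 i j)
    then show ?thesis by (intro exI[of _ i] exI[of _ j]) (simp add: white_def)
  next
    case (4 i j)
    then show ?thesis by (intro exI[of _ "Suc i"] exI[of _ j]) (simp add: white_def)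
  qed
  then show "w \<in> {white k i j | i j. i \<le> k \<and> j < k}"
    using face_left_white uv(3) by blast
next
  fix w assume "w \<in> {white k i j | i j. i \<le> k \<and> j < k}"
  then obtain i j where w: "w = white k i j" "i \<le> k" "j < k" by blast
  have "east k i j \<in> white k i j" by (simp add: white_def)
  then have "face_left (rot_G k) (east k i j) = w"
    using w by (simp add: face_left_white)
  then have "w \<in> faces (verts k) (rot_G k)"
    using east_is_dart[OF assms w(2), of j] w(3) unfolding faces_def by force
  moreover have "w \<noteq> outer_face_G k"
    using w east_notin_white outer_face_G_members[OF assms, of 0] by auto
  ultimately show "w \<in> whites k" by (simp add: whites_def)
qed

lemma white_eq_iff:
  assumes "k > 0" "i \<le> k" "i' \<le> k"
  shows "white k i j = white k i' j' \<longleftrightarrow> i = i' \<and> j = j'"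
proof
  assume "white k i j = white k i' j'"
  moreover have "east k i j \<in> white k i j" "west k i (Suc j) \<in> white k i j"
    by (simp_all add: white_def)
  ultimately have "east k i j \<in> white k i' j'" "west k i (Suc j) \<in> white k i' j'" by simp_all
  then show "i = i' \<and> j = j'"
    using assms by (auto simp: white_def dart_defs split: if_splits)
qed simp

section \<open>Edges of the Aztec diamond and their weights\<close>

lemma black_of_white_iff:
  assumes "i \<le> k" "i' < k"
  shows "(\<exists>u. (u, BV i' j') \<in> white k i j) \<longleftrightarrow> (i' = i \<or> Suc i' = i) \<and> (j' = j \<or> j' = Suc j)"
  using assms by (auto simp: white_def dart_defs)


lemma edges_A_eq:
  assumes "k > 0"
  shows "edges_A k = {(white k i j, BV i' j') | i j i' j'.
    i \<le> k \<and> j < k \<and> i' < k \<and> (i' = i \<or> Suc i' = i) \<and> (j' = j \<or> j' = Suc j)}"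
proof (intro Set.equalityI subsetI)
  fix e assume "e \<in> edges_A k"
  then obtain i j i' j' where e: "e = (white k i j, BV i' j')" "i \<le> k" "j < k" "i' < k"
    and "\<exists>u. (u, BV i' j') \<in> white k i j"
    unfolding edges_A_def whites_eq[OF assms] blacks_def by blast
  then have "(i' = i \<or> Suc i' = i) \<and> (j' = j \<or> j' = Suc j)"
    by (simp only: black_of_white_iff)
  with e show "e \<in> {(white k i j, BV i' j') | i j i' j'.
    i \<le> k \<and> j < k \<and> i' < k \<and> (i' = i \<or> Suc i' = i) \<and> (j' = j \<or> j' = Suc j)}"
    by blast
next
  fix e assume "e \<in> {(white k i j, BV i' j') | i j i' j'.
    i \<le> k \<and> j < k \<and> i' < k \<and> (i' = i \<or> Suc i' = i) \<and> (j' = j \<or> j' = Suc j)}"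
  then obtain i j i' j' where e: "e = (white k i j, BV i' j')" "i \<le> k" "j < k" "i' < k"
    and adj: "(i' = i \<or> Suc i' = i) \<and> (j' = j \<or> j' = Suc j)"
    by blast
  then have "\<exists>u. (u, BV i' j') \<in> white k i j"
    by (simp only: black_of_white_iff)
  moreover have "j' \<le> k" using adj e by auto
  ultimately show "e \<in> edges_A k"
    using e unfolding edges_A_def whites_eq[OF assms] blacks_def by blast
qed

lemma edges_A_iff:
  assumes "k > 0" "i \<le> k" "j < k"
  shows "(white k i j, BV i' j') \<in> edges_A k \<longleftrightarrow>
    i' < k \<and> (i' = i \<or> Suc i' = i) \<and> (j' = j \<or> j' = Suc j)"
  unfolding edges_A_eq[OF assms(1)] using assms by (auto simp: white_eq_iff)

lemma Hor_in_edges [simp]: "Hor i j \<in> edges k \<longleftrightarrow> i \<le> k \<and> j \<le> k"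
  and Ver_in_edges [simp]: "Ver i j \<in> edges k \<longleftrightarrow> i < k \<and> j < k"
  by (auto simp: edges_def)

text \<open>Simplicity of the graph: it makes the definite descriptions in \<open>f_before\<close>
  and \<open>f_after\<close> denote.\<close>

lemma ends_inj:
  assumes "k > 0" "e \<in> edges k" "e' \<in> edges k" "ends k e = ends k e'"
  shows "e = e'"
  using assms
  by (cases e; cases e') (auto simp: left_end_def right_end_def doubleton_eq_iff split: if_splits)

lemma f_before_eqI:
  assumes "k > 0" "e \<in> edges k" "(u, b) \<in> w" "ends k e = {u, b}" "\<And>v. (v, b) \<in> w \<Longrightarrow> v = u"
  shows "f_before k w b = e"
  unfolding f_before_def by (rule the_equality) (use assms ends_inj[OF assms(1)] in metis)+

lemma f_after_eqI:
  assumes "k > 0" "e \<in> edges k" "(b, u) \<in> w" "ends k e = {b, u}" "\<And>v. (b, v) \<in> w \<Longrightarrow> v = u"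
  shows "f_after k b w = e"
  unfolding f_after_def by (rule the_equality) (use assms ends_inj[OF assms(1)] in metis)+

lemma f_before_eq:
  assumes k: "k > 0" and ij: "i \<le> k" "j < k"
  shows "i < k \<Longrightarrow> f_before k (white k i j) (BV i j) = Hor i j"
    and "i < k \<Longrightarrow> f_before k (white k i j) (BV i (Suc j)) = Ver i j"
    and "Suc i' = i \<Longrightarrow> f_before k (white k i j) (BV i' j) = Ver i' j"
    and "Suc i' = i \<Longrightarrow> f_before k (white k i j) (BV i' (Suc j)) = Hor i (Suc j)"
proof -
  show "f_before k (white k i j) (BV i j) = Hor i j" if "i < k"
    by (rule f_before_eqI[OF k, where u = "left_end i j"])
      (use ij that in \<open>auto simp: white_def dart_defs split: if_splits\<close>)
  show "f_before k (white k i j) (BV i (Suc j)) = Ver i j" if "i < k"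
    by (rule f_before_eqI[OF k, where u = "BV i j"])
      (use ij that in \<open>auto simp: white_def dart_defs split: if_splits\<close>)
  show "f_before k (white k i j) (BV i' j) = Ver i' j" if "Suc i' = i"
    by (rule f_before_eqI[OF k, where u = "BV i' (Suc j)"])
      (use ij that in \<open>auto simp: white_def dart_defs split: if_splits\<close>)
  show "f_before k (white k i j) (BV i' (Suc j)) = Hor i (Suc j)" if "Suc i' = i"
    by (rule f_before_eqI[OF k, where u = "right_end k i (Suc j)"])
      (use ij that in \<open>auto simp: white_def dart_defs split: if_splits\<close>)
qed

lemma f_after_eq:
  assumes k: "k > 0" and ij: "i \<le> k" "j < k"
  shows "i < k \<Longrightarrow> f_after k (BV i j) (white k i j) = Ver i j"
    and "i < k \<Longrightarrow> f_after k (BV i (Suc j)) (white k i j) = Hor i (Suc j)"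
    and "Suc i' = i \<Longrightarrow> f_after k (BV i' j) (white k i j) = Hor i j"
    and "Suc i' = i \<Longrightarrow> f_after k (BV i' (Suc j)) (white k i j) = Ver i' j"
proof -
  show "f_after k (BV i j) (white k i j) = Ver i j" if "i < k"
    by (rule f_after_eqI[OF k, where u = "BV i (Suc j)"])
      (use ij that in \<open>auto simp: white_def dart_defs split: if_splits\<close>)
  show "f_after k (BV i (Suc j)) (white k i j) = Hor i (Suc j)" if "i < k"
    by (rule f_after_eqI[OF k, where u = "left_end i (Suc j)"])
      (use ij that in \<open>auto simp: white_def dart_defs split: if_splits\<close>)
  show "f_after k (BV i' j) (white k i j) = Hor i j" if "Suc i' = i"
    by (rule f_after_eqI[OF k, where u = "right_end k i j"])
      (use ij that in \<open>auto simp: white_def dart_defs split: if_splits\<close>)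
  show "f_after k (BV i' (Suc j)) (white k i j) = Ver i' j" if "Suc i' = i"
    by (rule f_after_eqI[OF k, where u = "BV i' j"])
      (use ij that in \<open>auto simp: white_def dart_defs split: if_splits\<close>)
qed

section \<open>The square faces of the Aztec diamond\<close>

lemma boundary_walk_3:
  assumes "face_step (rot_G k) a = b" "face_step (rot_G k) b = c" "face_step (rot_G k) c = a"
    and "distinct [a, b, c]"
  shows "boundary_walk k {a, b, c} \<in>
    {[fst a, fst b, fst c], [fst b, fst c, fst a], [fst c, fst a, fst b]}"
proof -
  define x where "x = (SOME x. x \<in> {a, b, c})"
  have "x \<in> {a, b, c}" unfolding x_def by (rule someI[of _ a]) simp
  moreover have "[0..<3] = [0, 1, 2 :: nat]" "card {a, b, c} = 3"
    using assms(4) by (simp_all add: upt_conv_Cons)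
  then have "boundary_walk k {a, b, c} =
      [fst x, fst (face_step (rot_G k) x), fst (face_step (rot_G k) (face_step (rot_G k) x))]"
    by (simp add: boundary_walk_def Let_def x_def[symmetric] numeral_2_eq_2 del: insert_iff)
  ultimately show ?thesis using assms(1-3) by auto
qed

lemma boundary_walk_4:
  assumes "face_step (rot_G k) a = b" "face_step (rot_G k) b = c" "face_step (rot_G k) c = d"
    and "face_step (rot_G k) d = a" "distinct [a, b, c, d]"
  shows "boundary_walk k {a, b, c, d} \<in>
    {[fst a, fst b, fst c, fst d], [fst b, fst c, fst d, fst a],
     [fst c, fst d, fst a, fst b], [fst d, fst a, fst b, fst c]}"
proof -
  define x where "x = (SOME x. x \<in> {a, b, c, d})"
  have "x \<in> {a, b, c, d}" unfolding x_def by (rule someI[of _ a]) simp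
  moreover have "[0..<4] = [0, 1, 2, 3 :: nat]" "card {a, b, c, d} = 4"
    using assms(5) by (simp_all add: upt_conv_Cons)
  then have "boundary_walk k {a, b, c, d} =
      [fst x, fst (face_step (rot_G k) x), fst (face_step (rot_G k) (face_step (rot_G k) x)),
       fst (face_step (rot_G k) (face_step (rot_G k) (face_step (rot_G k) x)))]"
    by (simp add: boundary_walk_def Let_def x_def[symmetric] numeral_2_eq_2 numeral_3_eq_3 del: insert_iff)
  ultimately show ?thesis using assms(1-4) by auto
qed

lemma BV_in_blacks [simp]: "BV i j \<in> blacks k \<longleftrightarrow> i < k \<and> j \<le> k"
  and BL_notin_blacks [simp]: "BL \<notin> blacks k"
  and BR_notin_blacks [simp]: "BR \<notin> blacks k"
  by (auto simp: blacks_def)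

text \<open>The starting point chosen by \<^const>\<open>boundary_walk\<close> is unknown, so \<^const>\<open>rot_A\<close> is known only up to rotation.\<close>

lemma rot_A_white_left:
  assumes "k > 0" "j < k"
  shows "rot_A k (White (white k 0 j)) \<in>
    {[Black (BV 0 j), Black (BV 0 (Suc j))], [Black (BV 0 (Suc j)), Black (BV 0 j)]}"
proof -
  have w: "white k 0 j = {east k 0 j, north 0 j, west k 0 (Suc j)}"
    using assms by (auto simp: white_def)
  have "distinct [east k 0 j, north 0 j, west k 0 (Suc j)]"
    using assms by (auto simp: dart_defs)
  then have "boundary_walk k (white k 0 j) \<in> {[fst (east k 0 j), fst (north 0 j), fst (west k 0 (Suc j))],
      [fst (north 0 j), fst (west k 0 (Suc j)), fst (east k 0 j)],
      [fst (west k 0 (Suc j)), fst (east k 0 j), fst (north 0 j)]}"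
    unfolding w using assms
    by (intro boundary_walk_3) (simp_all add: face_step_east face_step_west face_step_north)
  then show ?thesis using assms by (auto simp: dart_defs)
qed

lemma rot_A_white_right:
  assumes "k > 0" "j < k"
  shows "rot_A k (White (white k k j)) \<in>
    {[Black (BV (k - 1) j), Black (BV (k - 1) (Suc j))], [Black (BV (k - 1) (Suc j)), Black (BV (k - 1) j)]}"
proof -
  have w: "white k k j = {east k k j, west k k (Suc j), south (k - 1) j}"
    using assms by (auto simp: white_def)
  have "distinct [east k k j, west k k (Suc j), south (k - 1) j]"
    using assms by (auto simp: dart_defs)
  then have "boundary_walk k (white k k j) \<in> {[fst (east k k j), fst (west k k (Suc j)), fst (south (k - 1) j)],
      [fst (west k k (Suc j)), fst (south (k - 1) j), fst (east k k j)],
      [fst (south (k - 1) j), fst (east k k j), fst (west k k (Suc j))]}"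
    unfolding w using assms
    by (intro boundary_walk_3) (simp_all add: face_step_east face_step_west face_step_south)
  then show ?thesis using assms by (auto simp: dart_defs)
qed

lemma rot_A_white_inner:
  assumes "Suc i < k" "j < k"
  defines "a \<equiv> Black (BV i j)" and "b \<equiv> Black (BV (Suc i) j)"
    and "c \<equiv> Black (BV (Suc i) (Suc j))" and "d \<equiv> Black (BV i (Suc j))"
  shows "rot_A k (White (white k (Suc i) j)) \<in> {[a, b, c, d], [b, c, d, a], [c, d, a, b], [d, a, b, c]}"
proof -
  let ?E = "east k (Suc i) j" and ?N = "north (Suc i) j" and ?W = "west k (Suc i) (Suc j)" and ?S = "south i j"
  have w: "white k (Suc i) j = {?E, ?N, ?W, ?S}"
    using assms by (auto simp: white_def)
  have "distinct [?E, ?N, ?W, ?S]"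
    using assms by (auto simp: dart_defs)
  then have "boundary_walk k (white k (Suc i) j) \<in> {[fst ?E, fst ?N, fst ?W, fst ?S],
      [fst ?N, fst ?W, fst ?S, fst ?E], [fst ?W, fst ?S, fst ?E, fst ?N], [fst ?S, fst ?E, fst ?N, fst ?W]}"
    unfolding w using assms(1,2)
    by (intro boundary_walk_4) (simp_all add: face_step_east face_step_west face_step_north face_step_south)
  then show ?thesis using assms(1,2) unfolding a_def b_def c_def d_def by (auto simp: dart_defs)
qed

text \<open>Cyclic predecessors are the same for all rotations of a list, so the unknown starting
  point of the boundary walk disappears here.\<close>

lemma cyclic_pred_rot_A_white:
  assumes "j < k"
  shows "i < k \<Longrightarrow> cyclic_pred (rot_A k (White (white k i j))) (Black (BV i (Suc j))) = Black (BV i j)"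
    and "i < k \<Longrightarrow> cyclic_pred (rot_A k (White (white k (Suc i) j))) (Black (BV i j)) = Black (BV i (Suc j))"
    and "Suc i < k \<Longrightarrow> cyclic_pred (rot_A k (White (white k (Suc i) j))) (Black (BV i (Suc j))) =
      Black (BV (Suc i) (Suc j))"
    and "Suc i < k \<Longrightarrow> cyclic_pred (rot_A k (White (white k (Suc i) j))) (Black (BV (Suc i) j)) = Black (BV i j)"
proof -
  have k: "k > 0" using assms by simp
  note left = rot_A_white_left[OF k assms] and right = rot_A_white_right[OF k assms]
    and inner = rot_A_white_inner[OF _ assms]
  show "cyclic_pred (rot_A k (White (white k i j))) (Black (BV i (Suc j))) = Black (BV i j)" if "i < k"
  proof (cases i)
    case 0
    then show ?thesis using left by (auto simp: cyclic_pred_simps simp del: rot_A.simps)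
  next
    case (Suc i')
    then show ?thesis using inner[of i'] that by (auto simp: cyclic_pred_simps simp del: rot_A.simps)
  qed
  show "cyclic_pred (rot_A k (White (white k (Suc i) j))) (Black (BV i j)) = Black (BV i (Suc j))" if "i < k"
  proof (cases "Suc i = k")
    case True
    then have "i = k - 1" by simp
    then show ?thesis using right True by (auto simp: cyclic_pred_simps simp del: rot_A.simps)
  next
    case False
    then show ?thesis using inner[of i] that by (auto simp: cyclic_pred_simps simp del: rot_A.simps)
  qed
  show "cyclic_pred (rot_A k (White (white k (Suc i) j))) (Black (BV i (Suc j))) =
      Black (BV (Suc i) (Suc j))" if "Suc i < k"
    using inner[of i] that by (auto simp: cyclic_pred_simps simp del: rot_A.simps)
  show "cyclic_pred (rot_A k (White (white k (Suc i) j))) (Black (BV (Suc i) j)) = Black (BV i j)" if "Suc i < k"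
    using inner[of i] that by (auto simp: cyclic_pred_simps simp del: rot_A.simps)
qed

text \<open>The outer face is filtered out, which leaves two neighbours at the topmost and
  bottommost vertices and four elsewhere.\<close>

lemma rot_A_black:
  assumes "i < k" "j \<le> k"
  shows "rot_A k (Black (BV i j)) =
    map White ((if j < k then [white k (Suc i) j, white k i j] else []) @
      (if j > 0 then [white k i (j - 1), white k (Suc i) (j - 1)] else []))"
proof -
  have k: "k > 0" using assms by simp
  have in_whites: "white k i' j' \<in> whites k" if "i' \<le> k" "j' < k" for i' j'
    using that whites_eq[OF k] by blast
  have outer: "outer_face_G k \<notin> whites k" by (simp add: whites_def)
  have E: "face_left (rot_G k) (BV i j, right_end k (Suc i) j) =
      (if j < k then white k (Suc i) j else outer_face_G k)"
  proof -
    have e: "(BV i j, right_end k (Suc i) j) = east k (Suc i) j" by (simp add: dart_defs)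
    show ?thesis
    proof (cases "j < k")
      case True
      then have "east k (Suc i) j \<in> white k (Suc i) j" by (simp add: white_def)
      then show ?thesis using True assms e by (simp add: face_left_white)
    next
      case False
      then show ?thesis
        using face_left_outer[OF k] outer_face_G_members(1)[OF k, of "Suc i"] assms e by simp
    qed
  qed
  have W: "face_left (rot_G k) (BV i j, left_end i j) =
      (if j > 0 then white k i (j - 1) else outer_face_G k)"
  proof -
    have e: "(BV i j, left_end i j) = west k i j" using assms by (simp add: dart_defs)
    show ?thesis
    proof (cases "j > 0")
      case True
      then have "west k i j \<in> white k i (j - 1)" by (simp add: white_def)
      then show ?thesis using True assms e by (simp add: face_left_white)
    next
      case False
      then show ?thesis
        using face_left_outer[OF k] outer_face_G_members(2)[OF k, of i] assms e by simp
    qed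
  qed
  have N: "face_left (rot_G k) (BV i j, BV i (j + 1)) = white k i j" if "j < k"
  proof -
    have "(BV i j, BV i (j + 1)) \<in> white k i j" using assms that by (simp add: white_def north_def)
    then show ?thesis using assms that by (simp add: face_left_white)
  qed
  have S: "face_left (rot_G k) (BV i j, BV i (j - 1)) = white k (Suc i) (j - 1)" if "j > 0"
  proof -
    have "(BV i j, BV i (j - 1)) \<in> white k (Suc i) (j - 1)" using assms that by (simp add: white_def south_def)
    then show ?thesis using assms that by (intro face_left_white) auto
  qed
  show ?thesis
    using assms k N S by (auto simp: E W in_whites outer)
qed

text \<open>
  The bounded faces of \<open>A\<^sub>k\<close> are the squares around the edges \<open>g\<^sub>i\<^sub>,\<^sub>j\<close> and around the edges
  \<open>e\<^sub>i\<^sub>+\<^sub>1\<^sub>,\<^sub>j\<^sub>+\<^sub>1\<close> with both ends in \<open>B\<close> that are neither topmost nor bottommost.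
\<close>

definition vert_square :: "nat \<Rightarrow> nat \<Rightarrow> nat \<Rightarrow> (avert \<times> avert) set" where
  "vert_square k i j =
     {(Black (BV i j), White (white k (Suc i) j)), (White (white k (Suc i) j), Black (BV i (Suc j))),
      (Black (BV i (Suc j)), White (white k i j)), (White (white k i j), Black (BV i j))}"

definition hor_square :: "nat \<Rightarrow> nat \<Rightarrow> nat \<Rightarrow> (avert \<times> avert) set" where
  "hor_square k i j =
     {(Black (BV i (Suc j)), White (white k (Suc i) j)),
      (White (white k (Suc i) j), Black (BV (Suc i) (Suc j))),
      (Black (BV (Suc i) (Suc j)), White (white k (Suc i) (Suc j))),
      (White (white k (Suc i) (Suc j)), Black (BV i (Suc j)))}"

lemma cyclic_pred_rot_A_black:
  assumes "i < k" "j < k"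
  shows "cyclic_pred (rot_A k (Black (BV i (Suc j)))) (White (white k (Suc i) j)) = White (white k i j)"
    and "cyclic_pred (rot_A k (Black (BV i j))) (White (white k i j)) = White (white k (Suc i) j)"
    and "Suc j < k \<Longrightarrow> cyclic_pred (rot_A k (Black (BV i (Suc j)))) (White (white k i j)) =
      White (white k i (Suc j))"
    and "Suc j < k \<Longrightarrow> cyclic_pred (rot_A k (Black (BV i (Suc j)))) (White (white k (Suc i) (Suc j))) =
      White (white k (Suc i) j)"
proof -
  have ne: "white k (Suc i) j' \<noteq> white k i j''" "white k i j' \<noteq> white k (Suc i) j''" for j' j''
    using assms by (simp_all add: white_eq_iff)
  have ne': "white k i j \<noteq> white k i (Suc j)" "white k i (Suc j) \<noteq> white k i j"
    "white k (Suc i) j \<noteq> white k (Suc i) (Suc j)" "white k (Suc i) (Suc j) \<noteq> white k (Suc i) j"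
    using assms by (simp_all add: white_eq_iff)
  note rot = rot_A_black[OF assms(1)]
  have up: "rot_A k (Black (BV i (Suc j))) =
      (if Suc j < k then [White (white k (Suc i) (Suc j)), White (white k i (Suc j))] else []) @
      [White (white k i j), White (white k (Suc i) j)]"
    using assms rot[of "Suc j"] by (simp del: rot_A.simps)
  show "cyclic_pred (rot_A k (Black (BV i (Suc j)))) (White (white k (Suc i) j)) = White (white k i j)"
    by (cases "Suc j < k") (simp_all add: up cyclic_pred_simps ne ne' del: rot_A.simps)
  show "cyclic_pred (rot_A k (Black (BV i (Suc j)))) (White (white k i j)) = White (white k i (Suc j))"
    if "Suc j < k"
    using that by (simp add: up cyclic_pred_simps ne ne' del: rot_A.simps)
  show "cyclic_pred (rot_A k (Black (BV i (Suc j)))) (White (white k (Suc i) (Suc j))) =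
      White (white k (Suc i) j)" if "Suc j < k"
    using that by (simp add: up cyclic_pred_simps ne ne' del: rot_A.simps)
  show "cyclic_pred (rot_A k (Black (BV i j))) (White (white k i j)) = White (white k (Suc i) j)"
  proof (cases j)
    case 0
    then show ?thesis using assms rot[of 0] by (simp add: cyclic_pred_simps ne del: rot_A.simps)
  next
    case (Suc m)
    have "white k i j \<noteq> white k i m" "white k (Suc i) j \<noteq> white k (Suc i) m"
      using assms Suc by (simp_all add: white_eq_iff)
    then show ?thesis
      using assms rot[of j] Suc by (simp add: cyclic_pred_simps ne del: rot_A.simps)
  qed
qed

lemma face_left_vert_square:
  assumes "i < k" "j < k"
  shows "face_left (rot_A k) (Black (BV i j), White (white k (Suc i) j)) = vert_square k i j"
proof -
  have "cyclic_on (face_step (rot_A k)) (vert_square k i j)"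
    unfolding vert_square_def using assms
    by (intro cyclic_on_4)
      (simp_all add: face_step_def cyclic_pred_rot_A_white cyclic_pred_rot_A_black del: rot_A.simps)
  then show ?thesis
    unfolding face_left_def by (rule orbit_cyclic_eq3) (simp add: vert_square_def)
qed

lemma face_left_hor_square:
  assumes "Suc i < k" "Suc j < k"
  shows "face_left (rot_A k) (Black (BV i (Suc j)), White (white k (Suc i) j)) = hor_square k i j"
proof -
  have "cyclic_on (face_step (rot_A k)) (hor_square k i j)"
    unfolding hor_square_def using assms
    by (intro cyclic_on_4)
      (simp_all add: face_step_def cyclic_pred_rot_A_white cyclic_pred_rot_A_black del: rot_A.simps)
  then show ?thesis
    unfolding face_left_def by (rule orbit_cyclic_eq3) (simp add: hor_square_def)
qed

text \<open>This dart, the successor of the one defining the outer face, lies on none of the squares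
  and so shows that they are bounded. For \<open>k = 1\<close> the vertex b(0,1) is already topmost,
  and the walk passes directly to the face on its right.\<close>

lemma outer_face_A_member:
  assumes "k > 0"
  shows "(Black (BV 0 1), White (if k = 1 then white k 1 0 else white k 0 1)) \<in> outer_face_A k"
proof -
  have "(BV 0 0, BV 0 1) \<in> white k 0 0" using assms by (simp add: white_def north_def)
  then have w: "face_left (rot_G k) (BV 0 0, BV 0 1) = white k 0 0"
    using assms by (simp add: face_left_white)
  have "face_step (rot_A k) (White (white k 0 0), Black (BV 0 1)) =
      (Black (BV 0 1), White (if k = 1 then white k 1 0 else white k 0 1))"
  proof (cases "k = 1")
    case True
    then have "white k 0 0 \<noteq> white k 1 0" by (simp add: white_eq_iff)
    then show ?thesis
      using True rot_A_black[of 0 k 1] by (simp add: face_step_def cyclic_pred_simps del: rot_A.simps)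
  next
    case False
    then show ?thesis
      using assms cyclic_pred_rot_A_black(3)[of 0 k 0] by (simp add: face_step_def del: rot_A.simps)
  qed
  moreover have "face_step (rot_A k) (White (white k 0 0), Black (BV 0 1)) \<in> outer_face_A k"
    unfolding outer_face_A_def w unfolding face_left_def by (rule orbit.base)
  ultimately show ?thesis by (simp only:)
qed

lemma vert_square_bounded:
  assumes "i < k" "j < k"
  shows "vert_square k i j \<in> bounded_faces_A k"
proof -
  have k: "k > 0" using assms by simp
  have "Black (BV i j) \<in> verts_A k" using assms by (simp add: verts_A_def)
  moreover have "White (white k (Suc i) j) \<in> set (rot_A k (Black (BV i j)))"
    using assms by (simp add: rot_A_black del: rot_A.simps)
  ultimately have "vert_square k i j \<in> faces (verts_A k) (rot_A k)"
    unfolding faces_def using face_left_vert_square[OF assms, symmetric] by blast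
  moreover have "vert_square k i j \<noteq> outer_face_A k"
  proof
    assume "vert_square k i j = outer_face_A k"
    then have "(Black (BV 0 1), White (if k = 1 then white k 1 0 else white k 0 1)) \<in> vert_square k i j"
      using outer_face_A_member[OF k] by simp
    then consider "i = 0" "j = 1" "(if k = 1 then white k 1 0 else white k 0 1) = white k (Suc i) j"
      | "i = 0" "j = 0" "(if k = 1 then white k 1 0 else white k 0 1) = white k i j"
      unfolding vert_square_def by fastforce
    then show False
      by cases (use assms in \<open>simp_all add: white_eq_iff split: if_splits\<close>)
  qed
  ultimately show ?thesis by (simp add: bounded_faces_A_def)
qed

lemma hor_square_bounded:
  assumes "Suc i < k" "Suc j < k"
  shows "hor_square k i j \<in> bounded_faces_A k"
proof -
  have k: "k > 0" using assms by simp
  have "Black (BV i (Suc j)) \<in> verts_A k" using assms by (simp add: verts_A_def)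
  moreover have "White (white k (Suc i) j) \<in> set (rot_A k (Black (BV i (Suc j))))"
    using assms by (simp add: rot_A_black del: rot_A.simps)
  ultimately have "hor_square k i j \<in> faces (verts_A k) (rot_A k)"
    unfolding faces_def using face_left_hor_square[OF assms, symmetric] by blast
  moreover have "hor_square k i j \<noteq> outer_face_A k"
  proof
    assume "hor_square k i j = outer_face_A k"
    then have "(Black (BV 0 1), White (if k = 1 then white k 1 0 else white k 0 1)) \<in> hor_square k i j"
      using outer_face_A_member[OF k] by simp
    then have "i = 0" "j = 0" "(if k = 1 then white k 1 0 else white k 0 1) = white k (Suc i) j"
      unfolding hor_square_def by auto
    then show False
      using assms by (simp add: white_eq_iff split: if_splits)
  qed
  ultimately show ?thesis by (simp add: bounded_faces_A_def)
qed

lemma kasteleyn_vert_square: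
  assumes "kasteleyn_orientation k \<phi>" "i < k" "j < k"
  defines "p \<equiv> \<lambda>i j i' j'. \<phi> (White (white k i j), Black (BV i' j'))"
  shows "p i j i j * p i j i (Suc j) * p (Suc i) j i j * p (Suc i) j i (Suc j) = - 1"
proof -
  have ne: "white k (Suc i) j \<noteq> white k i j" using assms by (simp add: white_eq_iff)
  have "card (vert_square k i j) = 2 * 2" using ne by (simp add: vert_square_def)
  then have "(\<Prod>(w, b) \<in> {(w, b). (White w, Black b) \<in> vert_square k i j \<or> (Black b, White w) \<in> vert_square k i j}.
      \<phi> (White w, Black b)) = (-1) ^ (2 + 1)"
    using assms(1) vert_square_bounded[OF assms(2,3)] unfolding kasteleyn_orientation_def by blast
  moreover have "{(w, b). (White w, Black b) \<in> vert_square k i j \<or> (Black b, White w) \<in> vert_square k i j} =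
      {(white k i j, BV i j), (white k i j, BV i (Suc j)), (white k (Suc i) j, BV i j),
       (white k (Suc i) j, BV i (Suc j))}"
    by (auto simp: vert_square_def)
  ultimately show ?thesis using ne by (simp add: p_def mult.assoc)
qed

lemma kasteleyn_hor_square:
  assumes "kasteleyn_orientation k \<phi>" "Suc i < k" "Suc j < k"
  defines "p \<equiv> \<lambda>i j i' j'. \<phi> (White (white k i j), Black (BV i' j'))"
  shows "p (Suc i) j i (Suc j) * p (Suc i) j (Suc i) (Suc j) * p (Suc i) (Suc j) (Suc i) (Suc j) *
    p (Suc i) (Suc j) i (Suc j) = - 1"
proof -
  have ne: "white k (Suc i) (Suc j) \<noteq> white k (Suc i) j" using assms by (simp add: white_eq_iff)
  have "card (hor_square k i j) = 2 * 2" using ne by (simp add: hor_square_def)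
  then have "(\<Prod>(w, b) \<in> {(w, b). (White w, Black b) \<in> hor_square k i j \<or> (Black b, White w) \<in> hor_square k i j}.
      \<phi> (White w, Black b)) = (-1) ^ (2 + 1)"
    using assms(1) hor_square_bounded[OF assms(2,3)] unfolding kasteleyn_orientation_def by blast
  moreover have "{(w, b). (White w, Black b) \<in> hor_square k i j \<or> (Black b, White w) \<in> hor_square k i j} =
      {(white k (Suc i) j, BV i (Suc j)), (white k (Suc i) j, BV (Suc i) (Suc j)),
       (white k (Suc i) (Suc j), BV (Suc i) (Suc j)), (white k (Suc i) (Suc j), BV i (Suc j))}"
    by (auto simp: hor_square_def)
  ultimately show ?thesis using ne by (simp add: p_def mult.assoc)
qed

section \<open>From matchings to the determinant\<close>

text \<open>
  \<open>A\<close>, \<open>B\<close>, \<open>C\<close>, \<open>D\<close> are the values on the edges of \<open>A\<^sub>k\<close> from the faces \<open>(i, j)\<close> (twice) and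
  \<open>(i + 1, j)\<close> (twice) to the vertices \<open>b\<^sub>i\<^sub>,\<^sub>j\<close> and \<open>b\<^sub>i\<^sub>,\<^sub>j\<^sub>+\<^sub>1\<close>: a sign function with trivial product
  around every square is a coboundary.
\<close>

lemma flat_gauge:
  fixes A B C D :: "nat \<Rightarrow> nat \<Rightarrow> int"
  assumes unit: "\<And>i j. A i j \<in> {1, -1}" "\<And>i j. B i j \<in> {1, -1}"
      "\<And>i j. C i j \<in> {1, -1}" "\<And>i j. D i j \<in> {1, -1}"
    and vert: "\<And>i j. i < k \<Longrightarrow> j < k \<Longrightarrow> A i j * B i j * C i j * D i j = 1"
    and hor: "\<And>i j. Suc i < k \<Longrightarrow> Suc j < k \<Longrightarrow>
      D i j * B (Suc i) j * A (Suc i) (Suc j) * C i (Suc j) = 1"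
  obtains s t :: "nat \<Rightarrow> nat \<Rightarrow> int" where
    "\<And>i j. s i j \<in> {1, -1}" "\<And>i j. t i j \<in> {1, -1}"
    "\<And>i j. i < k \<Longrightarrow> j < k \<Longrightarrow> A i j = s i j * t i j \<and> B i j = s i j * t i (Suc j) \<and>
      C i j = s (Suc i) j * t i j \<and> D i j = s (Suc i) j * t i (Suc j)"
proof -
  have mult_unit: "x * y \<in> {1, -1}" if "x \<in> {1, -1}" "y \<in> {1, -1}" for x y :: int
    using that by auto
  have unit_inverse: "y = x" if "x * y = 1" "y \<in> {1, -1}" for x y :: int
    using that by auto
  \<comment> \<open>The product of the signs along a fixed path from face (0,0): up the leftmost
    faces through the vertices b(0,m+1), then to the right through the vertices b(m,j). A vertex
    above level 0 gets its value \<open>t\<close> from the face below it.\<close>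
  define s where "s i j = (\<Prod>m<j. A 0 (Suc m) * B 0 m) * (\<Prod>m<i. A m j * C m j)" for i j
  define t where "t i j = (case j of 0 \<Rightarrow> s i 0 * A i 0 | Suc m \<Rightarrow> s i m * B i m)" for i j
  have prod_unit: "(\<Prod>m<n. f m) \<in> {1, -1 :: int}" if "\<And>m. f m \<in> {1, -1}" for n and f :: "nat \<Rightarrow> int"
    by (induction n) (use that mult_unit in \<open>auto simp del: insert_iff\<close>)
  have s: "s i j \<in> {1, -1}" for i j
    unfolding s_def by (intro mult_unit prod_unit unit)
  have t: "t i j \<in> {1, -1}" for i j
    unfolding t_def by (cases j) (simp_all only: nat.case, (intro mult_unit s unit)+)
  have sq: "s i j * s i j = 1" "A i j * A i j = 1" "B i j * B i j = 1" "C i j * C i j = 1" for i j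
    using s[of i j] unit[of i j] by auto
  have s_Suc: "s (Suc i) j = s i j * (A i j * C i j)" for i j
    by (simp add: s_def mult.assoc)
  \<comment> \<open>Path independence: an upward step gives the same value in every column. Passing
    from one column to the next uses the square around a vertical edge and the one around a
    horizontal edge.\<close>
  have up: "s i (Suc j) = s i j * B i j * A i (Suc j)" if "i < k" "Suc j < k" for i j
    using that
  proof (induction i)
    case 0
    then show ?case by (simp add: s_def mult_ac)
  next
    case (Suc i)
    have v: "A i j * C i j = B i j * D i j"
      using vert[of i j] Suc.prems unit_inverse[of "A i j * C i j" "B i j * D i j"]
        mult_unit[OF unit(2)[of i j] unit(4)[of i j]]
      by (simp add: mult_ac)
    have h: "C i (Suc j) = D i j * B (Suc i) j * A (Suc i) (Suc j)"
      using unit_inverse[OF hor[of i j] unit(3)] Suc.prems by simp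
    have "s (Suc i) (Suc j) = s i j * B i j * (A i (Suc j) * A i (Suc j)) * C i (Suc j)"
      using Suc by (simp add: s_Suc mult_ac)
    also have "\<dots> = s i j * B i j * C i (Suc j)" by (simp add: sq)
    also have "\<dots> = s i j * (B i j * D i j) * B (Suc i) j * A (Suc i) (Suc j)"
      by (simp add: h mult_ac)
    also have "\<dots> = s (Suc i) j * B (Suc i) j * A (Suc i) (Suc j)"
      by (simp add: s_Suc v)
    finally show ?case .
  qed
  have A: "A i j = s i j * t i j" if "i < k" "j < k" for i j
  proof (cases j)
    case 0
    then show ?thesis using s[of i 0] by (auto simp: t_def)
  next
    case (Suc m)
    have "s i j * t i j = (s i m * s i m) * (B i m * B i m) * A i j"
      using up[of i m] that Suc by (simp add: t_def mult_ac)
    then show ?thesis by (simp add: sq)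
  qed
  have B: "B i j = s i j * t i (Suc j)" for i j
    using s[of i j] by (auto simp: t_def)
  have C: "C i j = s (Suc i) j * t i j" if "i < k" "j < k" for i j
  proof -
    have "s (Suc i) j * t i j = A i j * C i j * (s i j * t i j)" by (simp add: s_Suc mult_ac)
    also have "\<dots> = (A i j * A i j) * C i j" using A[OF that] by (simp add: mult_ac)
    finally show ?thesis by (simp add: sq)
  qed
  have D: "D i j = s (Suc i) j * t i (Suc j)" if "i < k" "j < k" for i j
  proof -
    have "s (Suc i) j * t i (Suc j) = A i j * C i j * (s i j * t i (Suc j))" by (simp add: s_Suc mult_ac)
    also have "\<dots> = A i j * B i j * C i j" using B[of i j] by (simp add: mult_ac)
    also have "\<dots> = D i j" using unit_inverse[OF vert[OF that] unit(4)] by simp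
    finally show ?thesis by simp
  qed
  show thesis using that[of s t] s t A B C D by blast
qed

section \<open>Numbering of faces and vertices, and the common sign of all matchings\<close>

definition wh :: "nat \<Rightarrow> nat \<Rightarrow> face" where
  "wh k p = white k (p mod Suc k) (p div Suc k)"

definition bl :: "nat \<Rightarrow> nat \<Rightarrow> vert" where
  "bl k q = BV (q mod k) (q div k)"

lemma bij_betw_wh:
  assumes "k > 0"
  shows "bij_betw (wh k) {..<k * Suc k} (whites k)"
proof (rule bij_betw_imageI)
  have le: "p mod Suc k \<le> k" for p by (simp add: less_Suc_eq_le[symmetric])
  show "inj_on (wh k) {..<k * Suc k}"
  proof (rule inj_onI)
    fix p q assume "wh k p = wh k q"
    then have "p mod Suc k = q mod Suc k" "p div Suc k = q div Suc k"
      using assms le by (simp_all add: wh_def white_eq_iff)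
    then show "p = q" by (metis div_mult_mod_eq)
  qed
  show "wh k ` {..<k * Suc k} = whites k"
  proof (intro Set.equalityI subsetI)
    fix w assume "w \<in> wh k ` {..<k * Suc k}"
    then obtain p where "p < k * Suc k" "w = wh k p" by auto
    moreover from this have "p div Suc k < k" by (simp add: less_mult_imp_div_less)
    ultimately show "w \<in> whites k"
      using le[of p] unfolding whites_eq[OF assms] wh_def by blast
  next
    fix w assume "w \<in> whites k"
    then obtain i j where w: "w = white k i j" "i \<le> k" "j < k" by (auto simp: whites_eq[OF assms])
    have "i + j * Suc k < Suc j * Suc k" using w by simp
    also have "\<dots> \<le> k * Suc k" using w by (intro mult_le_mono1) simp
    finally have "i + j * Suc k < k * Suc k" .
    moreover have "(i + j * Suc k) mod Suc k = i" "(i + j * Suc k) div Suc k = j"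
      using w(2) by (simp_all del: mult_Suc_right)
    then have "w = wh k (i + j * Suc k)" by (simp only: wh_def w)
    ultimately show "w \<in> wh k ` {..<k * Suc k}" by blast
  qed
qed

lemma bij_betw_bl:
  assumes "k > 0"
  shows "bij_betw (bl k) {..<k * Suc k} (blacks k)"
proof (rule bij_betw_imageI)
  show "inj_on (bl k) {..<k * Suc k}"
    by (rule inj_onI) (metis bl_def div_mult_mod_eq vert.inject)
  show "bl k ` {..<k * Suc k} = blacks k"
  proof (intro Set.equalityI subsetI)
    fix b assume "b \<in> bl k ` {..<k * Suc k}"
    then obtain q where q: "q < Suc k * k" "b = bl k q" by (auto simp: mult.commute)
    then have "q div k < Suc k" by (simp only: less_mult_imp_div_less)
    then show "b \<in> blacks k" using assms q(2) by (simp add: bl_def)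
  next
    fix b assume "b \<in> blacks k"
    then obtain i j where b: "b = BV i j" "i < k" "j \<le> k" by (auto simp: blacks_def)
    have "i + j * k < Suc j * k" using b by simp
    also have "\<dots> \<le> Suc k * k" using b by (intro mult_le_mono1) simp
    finally have "i + j * k < k * Suc k" by (simp add: mult.commute)
    moreover have "b = bl k (i + j * k)" using b by (simp add: bl_def)
    ultimately show "b \<in> bl k ` {..<k * Suc k}" by blast
  qed
qed

text \<open>Each square has exactly one edge from a face (i+1,j) to b(i,j+1). Negating \<phi> on
  these edges turns the square products from -1 to 1, so what remains splits into face signs and
  vertex signs. Their products over all faces and all vertices do not depend on \<sigma>, and the
  negated edges are the ones counted in \<open>sign_aztec\<close>.\<close>

lemma kasteleyn_sign:
  assumes "k > 0" "kasteleyn_orientation k \<phi>"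
  obtains \<epsilon> :: int where "\<epsilon> \<in> {1, -1}"
    "\<And>\<sigma>. \<sigma> permutes {0..<k * Suc k} \<Longrightarrow> (\<And>p. p < k * Suc k \<Longrightarrow> (wh k p, bl k (\<sigma> p)) \<in> edges_A k) \<Longrightarrow>
      (\<Prod>p<k * Suc k. \<phi> (White (wh k p), Black (bl k (\<sigma> p)))) = \<epsilon> * sign \<sigma>"
proof -
  define n where "n = k * Suc k"
  define f where "f i j i' j' = \<phi> (White (white k i j), Black (BV i' j'))" for i j i' j'
  have unit: "f i j i' j' \<in> {1, -1}"
    if "i \<le> k" "j < k" "i' < k" "i' = i \<or> Suc i' = i" "j' = j \<or> j' = Suc j" for i j i' j'
  proof -
    have "(white k i j, BV i' j') \<in> edges_A k" using that assms(1) by (simp add: edges_A_iff)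
    then show ?thesis using assms(2) unfolding kasteleyn_orientation_def f_def by blast
  qed
  \<comment> \<open>\<open>flat_gauge\<close> asks for units at all indices; outside the diamond the
    value is set to 1.\<close>
  define g where "g h i j = (if i < k \<and> j < k then h i j else 1 :: int)" for h i j
  obtain s t where s: "\<And>i j. s i j \<in> {1, -1 :: int}" and t: "\<And>i j. t i j \<in> {1, -1 :: int}"
    and st: "\<And>i j. i < k \<Longrightarrow> j < k \<Longrightarrow>
      g (\<lambda>i j. f i j i j) i j = s i j * t i j \<and> g (\<lambda>i j. f i j i (Suc j)) i j = s i j * t i (Suc j) \<and>
      g (\<lambda>i j. f (Suc i) j i j) i j = s (Suc i) j * t i j \<and>
      g (\<lambda>i j. - f (Suc i) j i (Suc j)) i j = s (Suc i) j * t i (Suc j)"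
  proof (rule flat_gauge[of "g (\<lambda>i j. f i j i j)" "g (\<lambda>i j. f i j i (Suc j))" "g (\<lambda>i j. f (Suc i) j i j)"
        "g (\<lambda>i j. - f (Suc i) j i (Suc j))" k])
    fix i j
    show "g (\<lambda>i j. f i j i j) i j \<in> {1, -1}" "g (\<lambda>i j. f i j i (Suc j)) i j \<in> {1, -1}"
      "g (\<lambda>i j. f (Suc i) j i j) i j \<in> {1, -1}" "g (\<lambda>i j. - f (Suc i) j i (Suc j)) i j \<in> {1, -1}"
      using unit[of i j i j] unit[of i j i "Suc j"] unit[of "Suc i" j i j] unit[of "Suc i" j i "Suc j"]
      by (auto simp: g_def)
  next
    fix i j assume "i < k" "j < k"
    then show "g (\<lambda>i j. f i j i j) i j * g (\<lambda>i j. f i j i (Suc j)) i j * g (\<lambda>i j. f (Suc i) j i j) i j *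
        g (\<lambda>i j. - f (Suc i) j i (Suc j)) i j = 1"
      using kasteleyn_vert_square[OF assms(2), of i j] by (simp add: g_def f_def)
  next
    fix i j assume "Suc i < k" "Suc j < k"
    then show "g (\<lambda>i j. - f (Suc i) j i (Suc j)) i j * g (\<lambda>i j. f i j i (Suc j)) (Suc i) j *
        g (\<lambda>i j. f i j i j) (Suc i) (Suc j) * g (\<lambda>i j. f (Suc i) j i j) i (Suc j) = 1"
      using kasteleyn_hor_square[OF assms(2), of i j] by (simp add: g_def f_def)
  qed blast
  have f_eq: "f i j i' j' = s i j * t i' j' * (if j' = Suc j \<and> Suc i' = i then - 1 else 1)"
    if "i \<le> k" "j < k" "i' < k" "i' = i \<or> Suc i' = i" "j' = j \<or> j' = Suc j" for i j i' j'
    using that st[of i' j] by (auto simp: g_def minus_equation_iff)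
  define S where "S = (\<Prod>p<n. s (p mod Suc k) (p div Suc k))"
  define T where "T = (\<Prod>q<n. t (q mod k) (q div k))"
  define c :: int where "c = (-1) ^ (k * ((\<Sum>q<n. q div k) - (\<Sum>p<n. p div Suc k)))"
  have prod_unit: "(\<Prod>m<n. f m) \<in> {1, -1 :: int}" if "\<And>m. f m \<in> {1, -1}" for n and f :: "nat \<Rightarrow> int"
  proof (induction n)
    case (Suc n)
    then show ?case using that[of n] by auto
  qed simp
  have c: "c \<in> {1, -1}" unfolding c_def by (simp add: uminus_power_if)
  have ST: "S * T * c \<in> {1, -1}"
    using prod_unit[of "\<lambda>p. s (p mod Suc k) (p div Suc k)" n] prod_unit[of "\<lambda>q. t (q mod k) (q div k)" n] s t c
    unfolding S_def T_def by auto
  have main: "(\<Prod>p<n. \<phi> (White (wh k p), Black (bl k (\<sigma> p)))) = S * T * c * sign \<sigma>"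
    if \<sigma>: "\<sigma> permutes {0..<n}" and edge: "\<And>p. p < n \<Longrightarrow> (wh k p, bl k (\<sigma> p)) \<in> edges_A k" for \<sigma>
  proof -
    have adj: "p mod Suc k \<le> k \<and> p div Suc k < k \<and> \<sigma> p mod k < k \<and>
        (\<sigma> p mod k = p mod Suc k \<or> Suc (\<sigma> p mod k) = p mod Suc k) \<and>
        (\<sigma> p div k = p div Suc k \<or> \<sigma> p div k = Suc (p div Suc k))" if "p < n" for p
    proof -
      have "p mod Suc k \<le> k" by (simp add: less_Suc_eq_le[symmetric])
      moreover have "p div Suc k < k" using that by (simp add: n_def less_mult_imp_div_less)
      ultimately show ?thesis
        using edge[OF that] assms(1) by (simp add: wh_def bl_def edges_A_iff)
    qed
    let ?h = "\<lambda>p. if \<sigma> p div k = Suc (p div Suc k) \<and> Suc (\<sigma> p mod k) = p mod Suc k then - 1 else 1 :: int"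
    have "(\<Prod>p<n. \<phi> (White (wh k p), Black (bl k (\<sigma> p)))) =
        (\<Prod>p<n. s (p mod Suc k) (p div Suc k) * t (\<sigma> p mod k) (\<sigma> p div k) * ?h p)"
    proof (rule prod.cong)
      fix p assume "p \<in> {..<n}"
      then show "\<phi> (White (wh k p), Black (bl k (\<sigma> p))) =
          s (p mod Suc k) (p div Suc k) * t (\<sigma> p mod k) (\<sigma> p div k) * ?h p"
        using f_eq[of "p mod Suc k" "p div Suc k" "\<sigma> p mod k" "\<sigma> p div k"] adj[of p]
        by (simp add: f_def wh_def bl_def)
    qed simp
    also have "\<dots> = S * (\<Prod>p<n. t (\<sigma> p mod k) (\<sigma> p div k)) * (\<Prod>p<n. ?h p)"
      by (simp only: prod.distrib S_def)
    also have "(\<Prod>p<n. t (\<sigma> p mod k) (\<sigma> p div k)) = T"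
      using prod.permute[OF \<sigma>, of "\<lambda>q. t (q mod k) (q div k)"] by (simp add: T_def lessThan_atLeast0 o_def)
    also have "(\<Prod>p<n. ?h p) = c * sign \<sigma>"
    proof -
      have "sign \<sigma> * (\<Prod>p<n. ?h p) = c"
        unfolding c_def using adj by (intro sign_aztec[OF assms(1) n_def \<sigma>]) blast+
      then have "c * sign \<sigma> = (sign \<sigma> * sign \<sigma>) * (\<Prod>p<n. ?h p)"
        by (simp only: mult_ac)
      then show ?thesis by (simp only: sign_idempotent mult_1)
    qed
    finally show ?thesis by (simp only: mult.assoc)
  qed
  show thesis using that[OF ST] main unfolding n_def by blast
qed

lemma bij_betw_perfect_matchings:
  fixes f :: "nat \<Rightarrow> 'w" and g :: "nat \<Rightarrow> 'b"
  assumes f: "bij_betw f {..<n} W" and g: "bij_betw g {..<n} B" and E: "E \<subseteq> W \<times> B"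
  shows "bij_betw (\<lambda>\<sigma>. (\<lambda>p. (f p, g (\<sigma> p))) ` {..<n})
    {\<sigma>. \<sigma> permutes {0..<n} \<and> (\<forall>p<n. (f p, g (\<sigma> p)) \<in> E)}
    {M. M \<subseteq> E \<and> (\<forall>w\<in>W. \<exists>!b. (w, b) \<in> M) \<and> (\<forall>b\<in>B. \<exists>!w. (w, b) \<in> M)}"
proof (rule bij_betw_imageI)
  let ?S = "{\<sigma>. \<sigma> permutes {0..<n} \<and> (\<forall>p<n. (f p, g (\<sigma> p)) \<in> E)}"
  let ?M = "\<lambda>\<sigma>. (\<lambda>p. (f p, g (\<sigma> p))) ` {..<n}"
  have f_eq: "f p = f q \<longleftrightarrow> p = q" if "p < n" "q < n" for p q
    using bij_betw_imp_inj_on[OF f] that by (simp add: inj_on_eq_iff)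
  have g_eq: "g p = g q \<longleftrightarrow> p = q" if "p < n" "q < n" for p q
    using bij_betw_imp_inj_on[OF g] that by (simp add: inj_on_eq_iff)
  have lt: "\<sigma> p < n" if "\<sigma> permutes {0..<n}" "p < n" for \<sigma> p
    using permutes_in_image[OF that(1), of p] that(2) by simp
  show "inj_on ?M ?S"
  proof (rule inj_onI)
    fix \<sigma> \<tau> assume \<sigma>: "\<sigma> \<in> ?S" and \<tau>: "\<tau> \<in> ?S" and eq: "?M \<sigma> = ?M \<tau>"
    show "\<sigma> = \<tau>"
    proof
      fix p
      show "\<sigma> p = \<tau> p"
      proof (cases "p < n")
        case True
        then have "(f p, g (\<sigma> p)) \<in> ?M \<tau>" using eq by blast
        then show ?thesis using True \<sigma> \<tau> lt by (auto simp: f_eq g_eq)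
      next
        case False
        then show ?thesis
            using \<sigma> \<tau> permutes_not_in[of \<sigma> "{0..<n}" p] permutes_not_in[of \<tau> "{0..<n}" p] by simp
      qed
    qed
  qed
  show "?M ` ?S = {M. M \<subseteq> E \<and> (\<forall>w\<in>W. \<exists>!b. (w, b) \<in> M) \<and> (\<forall>b\<in>B. \<exists>!w. (w, b) \<in> M)}"
  proof (intro Set.equalityI subsetI)
    fix M assume "M \<in> ?M ` ?S"
    then obtain \<sigma> where M: "M = ?M \<sigma>" and \<sigma>: "\<sigma> permutes {0..<n}" and edge: "\<forall>p<n. (f p, g (\<sigma> p)) \<in> E"
      by blast
    have "\<exists>!b. (w, b) \<in> M" if w: "w \<in> W" for w
    proof -
      obtain p where "p < n" "w = f p" using w bij_betw_imp_surj_on[OF f] by blast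
      then show ?thesis by (intro ex1I[of _ "g (\<sigma> p)"]) (auto simp: M f_eq)
    qed
    moreover have "\<exists>!w. (w, b) \<in> M" if b: "b \<in> B" for b
    proof -
      obtain q where q: "q < n" "b = g q" using b bij_betw_imp_surj_on[OF g] by blast
      obtain p where p: "p < n" "q = \<sigma> p"
        using q(1) permutes_image[OF \<sigma>] by (metis atLeastLessThan_iff imageE zero_le)
      have "p' = p" if "p' < n" "g (\<sigma> p') = b" for p'
        using that p q lt[OF \<sigma>] permutes_inj[OF \<sigma>] by (simp add: g_eq inj_eq)
      then show ?thesis using p q by (intro ex1I[of _ "f p"]) (auto simp: M)
    qed
    ultimately show "M \<in> {M. M \<subseteq> E \<and> (\<forall>w\<in>W. \<exists>!b. (w, b) \<in> M) \<and> (\<forall>b\<in>B. \<exists>!w. (w, b) \<in> M)}"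
      using M edge by auto
  next
    fix M assume "M \<in> {M. M \<subseteq> E \<and> (\<forall>w\<in>W. \<exists>!b. (w, b) \<in> M) \<and> (\<forall>b\<in>B. \<exists>!w. (w, b) \<in> M)}"
    then have ME: "M \<subseteq> E" and W1: "\<And>w. w \<in> W \<Longrightarrow> \<exists>!b. (w, b) \<in> M"
      and B1: "\<And>b. b \<in> B \<Longrightarrow> \<exists>!w. (w, b) \<in> M" by auto
    have "\<exists>q. q < n \<and> (f p, g q) \<in> M" if "p < n" for p
    proof -
      have "f p \<in> W" using that bij_betwE[OF f] by simp
      then obtain b where b: "(f p, b) \<in> M" using W1 by blast
      then have "b \<in> B" using ME E by blast
      then obtain q where "q < n" "b = g q" using bij_betw_imp_surj_on[OF g] by blast
      with b show ?thesis by blast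
    qed
    then obtain h where h: "\<And>p. p < n \<Longrightarrow> h p < n \<and> (f p, g (h p)) \<in> M" by metis
    define \<sigma> where "\<sigma> p = (if p < n then h p else p)" for p
    have inj: "inj_on \<sigma> {0..<n}"
    proof (rule inj_onI)
      fix p q assume pq: "p \<in> {0..<n}" "q \<in> {0..<n}" "\<sigma> p = \<sigma> q"
      then have "(f p, g (h p)) \<in> M" "(f q, g (h p)) \<in> M" "g (h p) \<in> B"
        using h[of p] h[of q] bij_betwE[OF g] by (auto simp: \<sigma>_def)
      then have "f p = f q" using B1 by blast
      then show "p = q" using pq by (simp add: f_eq)
    qed
    have \<sigma>: "\<sigma> permutes {0..<n}"
    proof (rule bij_imp_permutes)
      have "\<sigma> ` {0..<n} \<subseteq> {0..<n}" using h by (auto simp: \<sigma>_def)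
      then show "bij_betw \<sigma> {0..<n} {0..<n}"
        using inj by (simp add: bij_betw_def endo_inj_surj)
    qed (simp add: \<sigma>_def)
    have "M = ?M \<sigma>"
    proof (intro Set.equalityI subsetI)
      fix x assume "x \<in> M"
      then obtain w b where x: "x = (w, b)" "(w, b) \<in> M" "w \<in> W" using ME E by blast
      then obtain p where p: "p < n" "w = f p" using bij_betw_imp_surj_on[OF f] by blast
      then have "b = g (h p)" using W1[OF x(3)] x(2) h[of p] by blast
      then show "x \<in> ?M \<sigma>" using x p by (auto simp: \<sigma>_def)
    next
      fix x assume "x \<in> ?M \<sigma>"
      then show "x \<in> M" using h by (auto simp: \<sigma>_def)
    qed
    moreover have "(f p, g (\<sigma> p)) \<in> E" if "p < n" for p
      using h[OF that] that ME by (auto simp: \<sigma>_def)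
    ultimately show "M \<in> ?M ` ?S" using \<sigma> by blast
  qed
qed

section \<open>The partition function as a determinant\<close>

lemma aztec_mat_entry:
  fixes a :: "edge \<Rightarrow> 'a::comm_ring_1"
  assumes k: "k > 0" and p: "p < k * Suc k" and q: "q < k * Suc k"
    and d: "\<And>i j. i < k \<Longrightarrow> j < k \<Longrightarrow> a (Ver i j) = d i"
  shows "aztec_mat k (\<lambda>i j. a (Hor i j)) d $$ (p, q) =
    (if (wh k p, bl k q) \<in> edges_A k
     then a (f_before k (wh k p) (bl k q)) - a (f_after k (bl k q) (wh k p)) else 0)"
proof -
  define i j i' j' where ij: "i = p mod Suc k" "j = p div Suc k" "i' = q mod k" "j' = q div k"
  have i: "i \<le> k" by (simp add: ij less_Suc_eq_le[symmetric])
  have j: "j < k" using p by (simp add: ij less_mult_imp_div_less)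
  have i': "i' < k" using k by (simp add: ij)
  have "aztec_mat k (\<lambda>i j. a (Hor i j)) d $$ (p, q) =
      (if j' = j then bidiag (\<lambda>i j. a (Hor i j)) d j' i i'
       else if j' = Suc j then - bidiag (\<lambda>i j. a (Hor i j)) d j' i i' else 0)"
    using p q by (simp add: aztec_mat_def ij del: mult_Suc_right)
  also have "\<dots> = (if (white k i j, BV i' j') \<in> edges_A k
     then a (f_before k (white k i j) (BV i' j')) - a (f_after k (BV i' j') (white k i j)) else 0)"
    using k i j i' d by (auto simp: bidiag_def edges_A_iff f_before_eq f_after_eq)
  finally show ?thesis by (simp add: wh_def bl_def ij)
qed

text \<open>The sign is chosen before the weights: the same \<epsilon> serves the original, the
  rotated and the inverted weights, so it can be compared across them and cancels in
  \<open>Y\<close>.\<close>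

lemma Z_eq_det:
  assumes k: "k > 0" and \<phi>: "kasteleyn_orientation k \<phi>"
  obtains \<epsilon> :: int where "\<epsilon> \<in> {1, -1}"
    "\<And>(a :: edge \<Rightarrow> 'a::field) d. (\<And>i j. i < k \<Longrightarrow> j < k \<Longrightarrow> a (Ver i j) = d i) \<Longrightarrow>
      Z k a \<phi> = of_int \<epsilon> * det (aztec_mat k (\<lambda>i j. a (Hor i j)) d)"
proof -
  define n where "n = k * Suc k"
  obtain \<epsilon> where \<epsilon>: "\<epsilon> \<in> {1, -1}" and sign_eq: "\<And>\<sigma>. \<sigma> permutes {0..<n} \<Longrightarrow>
      (\<And>p. p < n \<Longrightarrow> (wh k p, bl k (\<sigma> p)) \<in> edges_A k) \<Longrightarrow>
      (\<Prod>p<n. \<phi> (White (wh k p), Black (bl k (\<sigma> p)))) = \<epsilon> * sign \<sigma>"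
    using kasteleyn_sign[OF assms] unfolding n_def by blast
  have "Z k a \<phi> = of_int \<epsilon> * det (aztec_mat k (\<lambda>i j. a (Hor i j)) d)"
    if d: "\<And>i j. i < k \<Longrightarrow> j < k \<Longrightarrow> a (Ver i j) = d i" for a :: "edge \<Rightarrow> 'a" and d
  proof -
    let ?X = "aztec_mat k (\<lambda>i j. a (Hor i j)) d"
    let ?w = "\<lambda>w b. a (f_before k w b) - a (f_after k b w)"
    let ?M = "\<lambda>\<sigma>. (\<lambda>p. (wh k p, bl k (\<sigma> p))) ` {..<n}"
    let ?S = "{\<sigma>. \<sigma> permutes {0..<n} \<and> (\<forall>p<n. (wh k p, bl k (\<sigma> p)) \<in> edges_A k)}"
    have lt: "\<sigma> p < n" if "\<sigma> permutes {0..<n}" "p < n" for \<sigma> p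
      using permutes_in_image[OF that(1), of p] that(2) by simp
    have bij: "bij_betw ?M ?S (perfect_matchings k)"
      unfolding perfect_matchings_def n_def
      by (rule bij_betw_perfect_matchings[OF bij_betw_wh[OF k] bij_betw_bl[OF k]]) (auto simp: edges_A_def)
    have entry: "?X $$ (p, \<sigma> p) = (if (wh k p, bl k (\<sigma> p)) \<in> edges_A k then ?w (wh k p) (bl k (\<sigma> p)) else 0)"
      if "\<sigma> permutes {0..<n}" "p < n" for \<sigma> p
      by (rule aztec_mat_entry) (use k d that lt in \<open>auto simp: n_def simp del: mult_Suc_right\<close>)
    have "Z k a \<phi> = (\<Sum>\<sigma>\<in>?S. \<Prod>(w, b)\<in>?M \<sigma>. of_int (\<phi> (White w, Black b)) * ?w w b)"
      unfolding Z_def by (rule sum.reindex_bij_betw[OF bij, symmetric])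
    also have "\<dots> = (\<Sum>\<sigma>\<in>?S. of_int \<epsilon> * (of_int (sign \<sigma>) * (\<Prod>p = 0..<n. ?X $$ (p, \<sigma> p))))"
    proof (rule sum.cong)
      fix \<sigma> assume "\<sigma> \<in> ?S"
      then have \<sigma>: "\<sigma> permutes {0..<n}" and edge: "\<And>p. p < n \<Longrightarrow> (wh k p, bl k (\<sigma> p)) \<in> edges_A k" by auto
      have "inj_on (\<lambda>p. (wh k p, bl k (\<sigma> p))) {..<n}"
        using bij_betw_imp_inj_on[OF bij_betw_wh[OF k]] by (auto simp: inj_on_def n_def)
      then have "(\<Prod>(w, b)\<in>?M \<sigma>. of_int (\<phi> (White w, Black b)) * ?w w b) =
          (\<Prod>p<n. of_int (\<phi> (White (wh k p), Black (bl k (\<sigma> p)))) * ?X $$ (p, \<sigma> p))"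
        using edge by (subst prod.reindex) (auto simp: entry[OF \<sigma>])
      also have "\<dots> = of_int (\<Prod>p<n. \<phi> (White (wh k p), Black (bl k (\<sigma> p)))) * (\<Prod>p<n. ?X $$ (p, \<sigma> p))"
        by (simp only: prod.distrib of_int_prod)
      also have "\<dots> = of_int \<epsilon> * (of_int (sign \<sigma>) * (\<Prod>p = 0..<n. ?X $$ (p, \<sigma> p)))"
        using sign_eq[OF \<sigma> edge] by (simp add: lessThan_atLeast0 mult.assoc)
      finally show "(\<Prod>(w, b)\<in>?M \<sigma>. of_int (\<phi> (White w, Black b)) * ?w w b) =
          of_int \<epsilon> * (of_int (sign \<sigma>) * (\<Prod>p = 0..<n. ?X $$ (p, \<sigma> p)))" .
    qed simp
    also have "\<dots> = (\<Sum>\<sigma> | \<sigma> permutes {0..<n}. of_int \<epsilon> * (of_int (sign \<sigma>) * (\<Prod>p = 0..<n. ?X $$ (p, \<sigma> p))))"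
    proof (rule sum.mono_neutral_left)
      show "\<forall>\<sigma>\<in>{\<sigma>. \<sigma> permutes {0..<n}} - ?S.
          of_int \<epsilon> * (of_int (sign \<sigma>) * (\<Prod>p = 0..<n. ?X $$ (p, \<sigma> p))) = 0"
      proof
        fix \<sigma> assume "\<sigma> \<in> {\<sigma>. \<sigma> permutes {0..<n}} - ?S"
        then obtain p where \<sigma>: "\<sigma> permutes {0..<n}" and p: "p < n" "(wh k p, bl k (\<sigma> p)) \<notin> edges_A k" by blast
        then have "?X $$ (p, \<sigma> p) = 0" using entry[OF \<sigma> p(1)] by simp
        then have "(\<Prod>p = 0..<n. ?X $$ (p, \<sigma> p)) = 0" using p(1) by (intro prod_zero) auto
        then show "of_int \<epsilon> * (of_int (sign \<sigma>) * (\<Prod>p = 0..<n. ?X $$ (p, \<sigma> p))) = 0" by simp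
      qed
    qed (auto simp: finite_permutations)
    also have "\<dots> = of_int \<epsilon> * det ?X"
      by (subst det_def'[of ?X n]) (simp_all add: aztec_mat_def n_def sum_distrib_left)
    finally show ?thesis .
  qed
  with \<epsilon> show thesis using that by blast
qed

section \<open>Products of weights and the invariance of \<open>Y\<close>\<close>

lemma prod_edges:
  fixes a :: "edge \<Rightarrow> 'a::comm_monoid_mult"
  shows "(\<Prod>f\<in>edges k. a f) = (\<Prod>i\<le>k. \<Prod>j\<le>k. a (Hor i j)) * (\<Prod>i<k. \<Prod>j<k. a (Ver i j))"
proof -
  have eq: "edges k = (\<lambda>(i, j). Hor i j) ` ({..k} \<times> {..k}) \<union> (\<lambda>(i, j). Ver i j) ` ({..<k} \<times> {..<k})"
    by (auto simp: edges_def)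
  have "(\<Prod>f\<in>edges k. a f) = (\<Prod>f\<in>(\<lambda>(i, j). Hor i j) ` ({..k} \<times> {..k}). a f) *
      (\<Prod>f\<in>(\<lambda>(i, j). Ver i j) ` ({..<k} \<times> {..<k}). a f)"
    unfolding eq by (rule prod.union_disjoint) auto
  also have "\<dots> = (\<Prod>(i, j)\<in>{..k} \<times> {..k}. a (Hor i j)) * (\<Prod>(i, j)\<in>{..<k} \<times> {..<k}. a (Ver i j))"
    by (simp add: prod.reindex inj_on_def case_prod_unfold)
  finally show ?thesis by (simp add: prod.cartesian_product)
qed

lemma prod_rotate:
  fixes h :: "nat \<Rightarrow> 'a::comm_monoid_mult"
  shows "(\<Prod>j\<le>k. h (Suc j mod Suc k)) = (\<Prod>j\<le>k. h j)"
proof -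
  have "(\<Prod>j\<le>k. h (Suc j mod Suc k)) = (\<Prod>j<k. h (Suc j)) * h 0"
    by (simp add: lessThan_Suc_atMost[symmetric])
  then show ?thesis
    by (simp add: lessThan_Suc_atMost[symmetric] prod.lessThan_Suc_shift mult.commute del: prod.lessThan_Suc)
qed

theorem theorem5p4:
  fixes k :: nat and a a' :: "edge \<Rightarrow> 'a::field" and d :: "nat \<Rightarrow> 'a"
  assumes "k \<ge> 1"
    and "\<And>i j. i < k \<Longrightarrow> j < k \<Longrightarrow> a (Ver i j) = d i"
    and "\<And>i j. i \<le> k \<Longrightarrow> j \<le> k \<Longrightarrow> a' (Hor i j) = a (Hor i ((j + 1) mod (k + 1)))"
    and "\<And>i j. i < k \<Longrightarrow> j < k \<Longrightarrow> a' (Ver i j) = d i"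
  shows "(\<forall>\<phi>. kasteleyn_orientation k \<phi> \<longrightarrow> Z k a \<phi> = (-1) ^ k * Z k a' \<phi>) \<and>
         (\<forall>\<phi> \<phi>'. kasteleyn_orientation k \<phi> \<longrightarrow> kasteleyn_orientation k \<phi>' \<longrightarrow> Y k a \<phi> = Y k a' \<phi>')"
proof -
  have k: "k > 0" using assms(1) by simp
  define X where "X a d = det (aztec_mat k (\<lambda>i j. a (Hor i j)) d)" for a :: "edge \<Rightarrow> 'a" and d
  have X: "X a d = (-1) ^ k * X a' d"
    unfolding X_def by (rule det_aztec_mat_rotate[OF k]) (simp add: assms(3))
  \<comment> \<open>Inverting the weights commutes with the rotation and keeps the vertical weights
    constant along columns, so the determinant identity applies again.\<close>
  have Xinv: "X (\<lambda>f. inverse (a f)) (\<lambda>i. inverse (d i)) = (-1) ^ k * X (\<lambda>f. inverse (a' f)) (\<lambda>i. inverse (d i))"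
    unfolding X_def by (rule det_aztec_mat_rotate[OF k]) (simp add: assms(3))
  have prods: "(\<Prod>f\<in>edges k. a' f) = (\<Prod>f\<in>edges k. a f)"
    unfolding prod_edges using assms(2-4) prod_rotate[of "\<lambda>j. a (Hor i j)" k for i] by simp
  have Z: "Z k a \<phi> = (-1) ^ k * Z k a' \<phi>" if \<phi>: "kasteleyn_orientation k \<phi>" for \<phi>
  proof -
    obtain \<epsilon> :: int where \<epsilon>: "\<And>(a :: edge \<Rightarrow> 'a) d. (\<And>i j. i < k \<Longrightarrow> j < k \<Longrightarrow> a (Ver i j) = d i) \<Longrightarrow>
        Z k a \<phi> = of_int \<epsilon> * X a d"
      using Z_eq_det[OF k \<phi>] unfolding X_def by metis
    show ?thesis using \<epsilon>[of a d] \<epsilon>[of a' d] assms(2,4) X by simp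
  qed
  \<comment> \<open>The sign \<epsilon> cancels in the quotient. The right-hand side no longer
    mentions \<phi>, which allows different orientations on the two sides of the claim.\<close>
  have Y: "Y k b \<phi> = (\<Prod>f\<in>edges k. b f) * (X (\<lambda>f. inverse (b f)) (\<lambda>i. inverse (d i)) / X b d)"
    if \<phi>: "kasteleyn_orientation k \<phi>" and b: "\<And>i j. i < k \<Longrightarrow> j < k \<Longrightarrow> b (Ver i j) = d i" for b \<phi>
  proof -
    obtain \<epsilon> :: int where unit: "\<epsilon> \<in> {1, -1}"
      and \<epsilon>: "\<And>(a :: edge \<Rightarrow> 'a) d. (\<And>i j. i < k \<Longrightarrow> j < k \<Longrightarrow> a (Ver i j) = d i) \<Longrightarrow>
        Z k a \<phi> = of_int \<epsilon> * X a d"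
      using Z_eq_det[OF k \<phi>] unfolding X_def by metis
    have "Z k b \<phi> = of_int \<epsilon> * X b d" using \<epsilon> b by blast
    moreover have "Z k (\<lambda>f. inverse (b f)) \<phi> = of_int \<epsilon> * X (\<lambda>f. inverse (b f)) (\<lambda>i. inverse (d i))"
      using \<epsilon>[of "\<lambda>f. inverse (b f)" "\<lambda>i. inverse (d i)"] b by simp
    ultimately show ?thesis using unit by (auto simp: Y_def)
  qed
  have "Y k a \<phi> = Y k a' \<phi>'" if "kasteleyn_orientation k \<phi>" "kasteleyn_orientation k \<phi>'" for \<phi> \<phi>'
  proof -
    \<comment> \<open>The factor occurs in numerator and denominator of the quotient and cancels,
      also under the convention for division by zero.\<close>
    have "(-1 :: 'a) ^ k \<noteq> 0" by simp
    then show ?thesis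
      using Y[OF that(1), of a] Y[OF that(2), of a'] assms(2,4) X Xinv prods by simp
  qed
  with Z show ?thesis by blast
qed

end
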